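(* Let $n,K\ge1$, $\mathbf q\ge\mathbf 0$ and $\mathbf s\ge\mathbf 0$. Then \[ c^{(\mathbf q;\mathbf s)}_{n,K}=\sum_{t_1=0}^{q_1}\cdots\sum_{t_n=0}^{q_n}\prod_{i=1}^n\frac{(2q_i+s_i)!}{2^{t_i}t_i!\,(s_i+q_i-t_i)!}\cdot v^{(\mathbf s)}_{n,K;(q_1-t_1+1,\dots,q_n-t_n+1)}. \] Furthermore, if for every $\mathbf R$ with $1\le R_i\le q_i+1$ ($1\le i\le n$) the quantity $v^{(\mathbf s)}_{n,K;\mathbf R}$ coincides, as a function of $K\ge1$, with a polynomial in $K$, then so does $c^{(\mathbf q;\mathbf s)}_{n,K}$.
   Context: Notation: $\mathbf q=(q_1,\dots,q_n)$ and $\mathbf s=(s_{i,k})_{1\le i<k\le n}$ non-negative integers, $s_{k,i}=s_{i,k}$, $s_i=\sum_{k\ne i}s_{i,k}$, $p_i=2q_i+s_i$. Given $\mathbf R=(R_1,\dots,R_n)$ with $1\le R_i\le K$, a paired array with parameters $(n,K,\mathbf R,\mathbf q,\mathbf s)$ is an $n\times K$ grid of cells, each cell containing a possibly empty left-to-right ordered list of unlabelled vertices, row $i$ containing $p_i$ vertices; the vertices are partitioned into pairs (partners) with exactly $q_i$ pairs inside row $i$ and exactly $s_{i,k}$ pairs between rows $i$ and $k$; exactly $R_i$ cells of row $i$ are marked. Arrays are equal if they have the same vertex counts per cell, marked cells, and pairing of vertex positions. Mixed pairs/vertices: pairs with vertices in different rows. Balance condition: for every cell $(i,j)$, the number of mixed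 vertices in $(i,j)$ equals the number of mixed pairs $\{u,v\}$ with $u$ in row $i$ and $v$ in column $j$. Forest condition: for each row $i$, with $\mathcal R_i$ its marked columns, $\mathcal F_i$ its columns with nonempty cell, and $\psi_i:\mathcal F_i\setminus\mathcal R_i\to\{1,\dots,K\}$ sending $j$ to the column of the partner of the rightmost vertex of cell $(i,j)$, every $j\in\mathcal F_i\setminus\mathcal R_i$ has some $t\ge1$ with $\psi_i^t(j)$ defined and in $\mathcal R_i$. Proper = satisfies both. $c^{(\mathbf q;\mathbf s)}_{n,K}$ is the number of proper paired arrays with $\mathbf R=(1,\dots,1)$. A vertical array is a paired array with $\mathbf q=\mathbf 0$; $v^{(\mathbf s)}_{n,K;\mathbf R}$ is the number of proper vertical arrays with parameters $(n,K,\mathbf R,\mathbf 0,\mathbf s)$, and for $\mathbf R\ge\mathbf 1$ with some $R_i>K$ one sets $v^{(\mathbf s)}_{n,K;\mathbf R}=0$. *)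

theory Defs
  imports "HOL-Library.Disjoint_Sets" "HOL-Library.FuncSet"
    "HOL-Computational_Algebra.Polynomial"
begin

text \<open>
  Rows are indexed by \<open>{1..n}\<close> and columns by \<open>{1..K}\<close>.  As the vertices of an array are
  unlabelled, a vertex is identified with its position: \<open>(i, j, l)\<close> is the vertex in cell
  \<open>(i, j)\<close> that has exactly \<open>l\<close> vertices to its left in that cell.  Equality of the
  datatype below is then equality of vertex counts, marked cells and pairing of positions.
\<close>

type_synonym vertex = "nat \<times> nat \<times> nat"

definition row :: "vertex \<Rightarrow> nat" where
  "row v = fst v"

definition col :: "vertex \<Rightarrow> nat" where
  "col v = fst (snd v)"

datatype array =
  Array (num: "nat \<Rightarrow> nat \<Rightarrow> nat") (marked: "(nat \<times> nat) set") (pairing: "vertex set set")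

definition vertices :: "array \<Rightarrow> vertex set" where
  "vertices A = {(i, j, l). l < num A i j}"

definition row_sum :: "nat \<Rightarrow> (nat \<Rightarrow> nat \<Rightarrow> nat) \<Rightarrow> nat \<Rightarrow> nat" where
  "row_sum n s i = (\<Sum>k\<in>{1..n} - {i}. s i k)"

definition marked_cols :: "array \<Rightarrow> nat \<Rightarrow> nat set" where
  "marked_cols A i = {j. (i, j) \<in> marked A}"

definition nonempty_cols :: "array \<Rightarrow> nat \<Rightarrow> nat set" where
  "nonempty_cols A i = {j. num A i j \<noteq> 0}"

text \<open>
  The second conjunct confines all vertices to the grid, so that an array is determined by
  its cells.  The values of \<open>R\<close>, \<open>q\<close>, \<open>s\<close> at indices outside \<open>{1..n}\<close> and the diagonal
  values \<open>s i i\<close> are irrelevant.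
\<close>

definition paired_array ::
  "nat \<Rightarrow> nat \<Rightarrow> (nat \<Rightarrow> nat) \<Rightarrow> (nat \<Rightarrow> nat) \<Rightarrow> (nat \<Rightarrow> nat \<Rightarrow> nat) \<Rightarrow> array \<Rightarrow> bool" where
  "paired_array n K R q s A \<longleftrightarrow>
     (\<forall>i\<in>{1..n}. 1 \<le> R i \<and> R i \<le> K) \<and>
     (\<forall>i j. (i, j) \<notin> {1..n} \<times> {1..K} \<longrightarrow> num A i j = 0) \<and>
     (\<forall>i\<in>{1..n}. (\<Sum>j=1..K. num A i j) = 2 * q i + row_sum n s i) \<and>
     marked A \<subseteq> {1..n} \<times> {1..K} \<and>
     (\<forall>i\<in>{1..n}. card (marked_cols A i) = R i) \<and>
     partition_on (vertices A) (pairing A) \<and>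
     (\<forall>p\<in>pairing A. card p = 2) \<and>
     (\<forall>i\<in>{1..n}. card {p \<in> pairing A. \<forall>v\<in>p. row v = i} = q i) \<and>
     (\<forall>i\<in>{1..n}. \<forall>k\<in>{1..n}. i < k \<longrightarrow>
        card {p \<in> pairing A. (\<exists>u\<in>p. row u = i) \<and> (\<exists>v\<in>p. row v = k)} = s i k)"

definition mixed_pairs :: "array \<Rightarrow> vertex set set" where
  "mixed_pairs A = {p \<in> pairing A. \<exists>u\<in>p. \<exists>v\<in>p. row u \<noteq> row v}"

definition mixed_vertices :: "array \<Rightarrow> vertex set" where
  "mixed_vertices A = \<Union> (mixed_pairs A)"

definition balanced :: "nat \<Rightarrow> nat \<Rightarrow> array \<Rightarrow> bool" where
  "balanced n K A \<longleftrightarrow>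
     (\<forall>i\<in>{1..n}. \<forall>j\<in>{1..K}.
        card {v \<in> mixed_vertices A. row v = i \<and> col v = j} =
        card {p \<in> mixed_pairs A. \<exists>u v. p = {u, v} \<and> row u = i \<and> col v = j})"

definition partner :: "array \<Rightarrow> vertex \<Rightarrow> vertex" where
  "partner A v = (THE w. w \<noteq> v \<and> {v, w} \<in> pairing A)"

definition rightmost :: "array \<Rightarrow> nat \<Rightarrow> nat \<Rightarrow> vertex" where
  "rightmost A i j = (i, j, num A i j - 1)"

definition psi :: "array \<Rightarrow> nat \<Rightarrow> nat \<Rightarrow> nat option" where
  "psi A i j =
     (if j \<in> nonempty_cols A i - marked_cols A i
      then Some (col (partner A (rightmost A i j))) else None)"

definition psi_iter :: "array \<Rightarrow> nat \<Rightarrow> nat \<Rightarrow> nat \<Rightarrow> nat option" where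
  "psi_iter A i t j = ((\<lambda>x. Option.bind x (psi A i)) ^^ t) (Some j)"

definition forest :: "nat \<Rightarrow> array \<Rightarrow> bool" where
  "forest n A \<longleftrightarrow>
     (\<forall>i\<in>{1..n}. \<forall>j\<in>nonempty_cols A i - marked_cols A i.
        \<exists>t\<ge>1. \<exists>m\<in>marked_cols A i. psi_iter A i t j = Some m)"

definition proper_array ::
  "nat \<Rightarrow> nat \<Rightarrow> (nat \<Rightarrow> nat) \<Rightarrow> (nat \<Rightarrow> nat) \<Rightarrow> (nat \<Rightarrow> nat \<Rightarrow> nat) \<Rightarrow> array \<Rightarrow> bool" where
  "proper_array n K R q s A \<longleftrightarrow> paired_array n K R q s A \<and> balanced n K A \<and> forest n A"

definition c_num :: "nat \<Rightarrow> nat \<Rightarrow> (nat \<Rightarrow> nat) \<Rightarrow> (nat \<Rightarrow> nat \<Rightarrow> nat) \<Rightarrow> nat" where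
  "c_num n K q s = card {A. proper_array n K (\<lambda>_. 1) q s A}"

definition v_num :: "nat \<Rightarrow> nat \<Rightarrow> (nat \<Rightarrow> nat) \<Rightarrow> (nat \<Rightarrow> nat \<Rightarrow> nat) \<Rightarrow> nat" where
  "v_num n K R s =
     (if \<exists>i\<in>{1..n}. R i > K then 0 else card {A. proper_array n K R (\<lambda>_. 0) s A})"

end

theory Submission imports Defs begin

text \<open>
  Count proper arrays with a distinguished ordered non-mixed pair \<open>(u, v)\<close> in row \<open>i\<close> by deleting
  that pair.  Write \<open>L\<close> for the number of remaining vertices of the row and \<open>m = R i\<close>.  Call a
  vertex critical (\<open>unmarked_last\<close>) if it is the last one of an unmarked cell; only critical vertices matter for
  the forest condition.

  If neither vertex is critical, deletion keeps the forest, and the pair can be put back into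
  \<open>(L + m) (L + m + 1)\<close> places.  If \<open>u\<close> is critical in the cell \<open>x\<close>, mark \<open>x\<close> after the deletion:
  this gives a forest with \<open>m + 1\<close> roots, and \<open>v\<close> may be put back into any of the
  \<open>L + m + 1\<close> places, for each of the \<open>m\<close> choices of a root \<open>x\<close> whose tree does not contain that
  place.  The two vertices are never both critical, as their columns would form a cycle.  Hence
  the number \<open>N(m, c)\<close> of proper arrays with \<open>c\<close> non-mixed pairs in row \<open>i\<close> satisfies
  \<open>2 (c + 1) N(m, c + 1) = (L + m) (L + m + 1) N(m, c) + 2 m (L + m + 1) N(m + 1, c)\<close>,
  which is solved explicitly, one row after another.
\<close>

subsection \<open>Inserting a pair\<close>

definition pos :: "vertex \<Rightarrow> nat" where
  "pos v = snd (snd v)"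

lemma vertex_eqI: "row u = row v \<Longrightarrow> col u = col v \<Longrightarrow> pos u = pos v \<Longrightarrow> u = v"
  by (simp add: row_def col_def pos_def prod_eq_iff)

lemma vertex_simps [simp]:
  "row (i, j, l) = i" "col (i, j, l) = j" "pos (i, j, l) = l"
  by (simp_all add: row_def col_def pos_def)

text \<open>The position that an old vertex \<open>w\<close> receives when a new vertex is inserted
  at \<open>u\<close>: only vertices of that cell at or to the right of \<open>pos u\<close> move.
  \<open>skip u\<close> is a bijection from all positions onto those different from
  \<open>u\<close>, and it keeps rows and columns.\<close>

definition skip :: "vertex \<Rightarrow> vertex \<Rightarrow> vertex" where
  "skip u w = (row w, col w,
     if row w = row u \<and> col w = col u \<and> pos u \<le> pos w then Suc (pos w) else pos w)"

lemma row_skip [simp]: "row (skip u w) = row w"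
  and col_skip [simp]: "col (skip u w) = col w"
  and pos_skip: "pos (skip u w) =
    (if row w = row u \<and> col w = col u \<and> pos u \<le> pos w then Suc (pos w) else pos w)"
  by (simp_all add: skip_def)

lemma skip_neq: "skip u w \<noteq> u"
proof
  assume "skip u w = u"
  then have "row w = row u" "col w = col u" "pos (skip u w) = pos u"
    by (metis row_skip, metis col_skip, simp)
  then show False
    by (simp add: pos_skip split: if_splits)
qed

lemma inj_skip: "inj (skip u)"
proof (rule injI)
  fix w w' assume eq: "skip u w = skip u w'"
  then have rc: "row w = row w'" "col w = col w'" and "pos (skip u w) = pos (skip u w')"
    by (metis row_skip, metis col_skip, simp)
  then have "pos w = pos w'"
    by (auto simp: pos_skip split: if_splits)
  with rc show "w = w'"
    by (intro vertex_eqI)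
qed

lemma skip_surj:
  assumes "w \<noteq> u"
  obtains w' where "w = skip u w'"
proof (cases "row w = row u \<and> col w = col u \<and> pos u < pos w")
  case True
  then have "w = skip u (row w, col w, pos w - 1)"
    by (intro vertex_eqI) (auto simp: pos_skip)
  then show ?thesis by (rule that)
next
  case False
  then have "\<not> (row w = row u \<and> col w = col u \<and> pos u \<le> pos w)"
    using assms vertex_eqI[of w u] by auto
  then have "w = skip u w"
    by (intro vertex_eqI) (auto simp: pos_skip)
  then show ?thesis by (rule that)
qed

lemma range_skip: "range (skip u) = - {u}"
proof -
  have "w \<in> range (skip u) \<longleftrightarrow> w \<noteq> u" for w
    using skip_neq skip_surj[of w u] by (metis rangeI image_iff)
  then show ?thesis by blast
qed

lemma inj_image_blocks: "inj f \<Longrightarrow> inj ((`) f)"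
  by (metis injI inj_image_eq_iff)

definition add_cell :: "vertex \<Rightarrow> (nat \<Rightarrow> nat \<Rightarrow> nat) \<Rightarrow> nat \<Rightarrow> nat \<Rightarrow> nat" where
  "add_cell u f = (\<lambda>i j. if i = row u \<and> j = col u then Suc (f i j) else f i j)"

lemma add_cell_inject: "add_cell u f = add_cell u g \<longleftrightarrow> f = g"
  by (auto simp: add_cell_def fun_eq_iff split: if_splits)

text \<open>The vertex set depends on the counts alone. Stating it for a count function also covers
  the intermediate stage of an insertion, when only one of the two vertices is present.\<close>

definition below :: "(nat \<Rightarrow> nat \<Rightarrow> nat) \<Rightarrow> vertex set" where
  "below f = {w. pos w < f (row w) (col w)}"

lemma vertices_eq_below: "vertices A = below (num A)"
  by (auto simp: vertices_def below_def row_def col_def pos_def)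

text \<open>The hypothesis admits every gap of the cell, including the one after its last vertex, so
  the occupied positions still form an initial segment.\<close>

lemma below_add_cell:
  assumes "pos u \<le> f (row u) (col u)"
  shows "below (add_cell u f) = insert u (skip u ` below f)"
proof (intro set_eqI iffI)
  fix w assume w: "w \<in> below (add_cell u f)"
  show "w \<in> insert u (skip u ` below f)"
  proof (cases "w = u")
    case False
    then obtain w' where w': "w = skip u w'" by (rule skip_surj)
    then have "w' \<in> below f"
      using w assms by (auto simp: below_def add_cell_def pos_skip split: if_splits)
    with w' show ?thesis by simp
  qed simp
next
  fix w assume "w \<in> insert u (skip u ` below f)"
  then show "w \<in> below (add_cell u f)"
    using assms by (auto simp: below_def add_cell_def pos_skip)
qed

section \<open>Perfect matchings of the vertices, and insertion of a matched pair\<close>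

definition well_paired :: "array \<Rightarrow> bool" where
  "well_paired A \<longleftrightarrow> partition_on (vertices A) (pairing A) \<and> (\<forall>p\<in>pairing A. card p = 2)"

lemma partner_eq:
  assumes "well_paired A" "{v, w} \<in> pairing A" "v \<noteq> w"
  shows "partner A v = w"
  unfolding partner_def
proof (rule the_equality)
  show "w \<noteq> v \<and> {v, w} \<in> pairing A" using assms by auto
next
  fix x assume x: "x \<noteq> v \<and> {v, x} \<in> pairing A"
  have "disjoint (pairing A)" using assms(1) by (auto simp: well_paired_def partition_on_def)
  then have "{v, x} = {v, w}"
    using disjointD[of "pairing A" "{v, x}" "{v, w}"] x assms(2) by auto
  then show "x = w" using x by (auto simp: doubleton_eq_iff)
qed

lemma well_paired_partnerE:
  assumes "well_paired A" "v \<in> vertices A"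
  obtains w where "{v, w} \<in> pairing A" "v \<noteq> w" "partner A v = w"
proof -
  obtain p where p: "p \<in> pairing A" "v \<in> p"
    using assms by (auto simp: well_paired_def partition_on_def)
  then have "card p = 2" using assms by (auto simp: well_paired_def)
  then obtain w where "p = {v, w}" "v \<noteq> w"
    using p(2) by (auto simp: card_2_iff)
  with p partner_eq[OF assms(1)] that show ?thesis by metis
qed

text \<open>The vertex \<open>v\<close> is inserted first and \<open>u\<close> second. Hence
  \<open>v\<close> is a position in the array without \<open>u\<close>, and the final position of
  that vertex is \<open>skip u v\<close>.\<close>

definition skip2 :: "vertex \<Rightarrow> vertex \<Rightarrow> vertex \<Rightarrow> vertex" where
  "skip2 u v w = skip u (skip v w)"

lemma row_skip2 [simp]: "row (skip2 u v w) = row w"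
  and col_skip2 [simp]: "col (skip2 u v w) = col w"
  by (simp_all add: skip2_def)

lemma inj_skip2: "inj (skip2 u v)"
  by (rule injI) (metis skip2_def injD[OF inj_skip])

lemma range_skip2: "range (skip2 u v) = - {u, skip u v}"
proof -
  have "range (skip2 u v) = skip u ` (- {v})"
    unfolding range_skip[of v, symmetric] image_image skip2_def ..
  also have "\<dots> = range (skip u) - {skip u v}"
    by (subst Compl_eq_Diff_UNIV, subst image_set_diff[OF inj_skip]) simp
  finally show ?thesis unfolding range_skip by blast
qed

text \<open>The new set of marks is a separate argument, because undoing the deletion of a critical
  pair also has to remove a mark.\<close>

definition ins_pair :: "(nat \<times> nat) set \<Rightarrow> vertex \<Rightarrow> vertex \<Rightarrow> array \<Rightarrow> array" where
  "ins_pair M u v A = Array (add_cell u (add_cell v (num A))) M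
     (insert {u, skip u v} ((`) (skip2 u v) ` pairing A))"

lemma ins_pair_sel [simp]:
  "num (ins_pair M u v A) = add_cell u (add_cell v (num A))"
  "marked (ins_pair M u v A) = M"
  "pairing (ins_pair M u v A) = insert {u, skip u v} ((`) (skip2 u v) ` pairing A)"
  by (simp_all add: ins_pair_def)

lemma notin_skip2_image: "{u, skip u v} \<notin> (`) (skip2 u v) ` P"
proof
  assume "{u, skip u v} \<in> (`) (skip2 u v) ` P"
  then have "u \<in> range (skip2 u v)" by blast
  then show False by (simp only: range_skip2) simp
qed

lemma ins_pair_inject:
  assumes "ins_pair M u v A = ins_pair M u v B"
  shows "num A = num B" "pairing A = pairing B"
proof -
  from assms have "num (ins_pair M u v A) = num (ins_pair M u v B)"
    and p: "pairing (ins_pair M u v A) = pairing (ins_pair M u v B)" by simp_all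
  then show "num A = num B" by (simp add: add_cell_inject)
  from p have "(`) (skip2 u v) ` pairing A = (`) (skip2 u v) ` pairing B"
    using notin_skip2_image[of u v] by (metis ins_pair_sel(3) insert_ident)
  then show "pairing A = pairing B"
    by (simp only: inj_image_eq_iff[OF inj_image_blocks[OF inj_skip2]])
qed

lemma partition_on_image:
  assumes "inj f"
  shows "partition_on (f ` V) ((`) f ` P) \<longleftrightarrow> partition_on V P"
proof -
  have "(\<Union>p\<in>P. f ` p) = f ` V \<longleftrightarrow> \<Union>P = V"
    by (metis assms image_Union inj_image_eq_iff)
  moreover have "f ` p \<inter> f ` p' = {} \<longleftrightarrow> p \<inter> p' = {}" for p p'
    using assms by (auto simp: inj_def)
  then have "disjoint ((`) f ` P) \<longleftrightarrow> disjoint P"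
    by (simp add: disjoint_def inj_image_eq_iff[OF assms])
  ultimately show ?thesis by (auto simp: partition_on_def)
qed

lemma partition_on_insert_block:
  assumes "W \<inter> V = {}" "W \<noteq> {}" "W \<notin> P" "\<Union>P \<inter> W = {}"
  shows "partition_on (W \<union> V) (insert W P) \<longleftrightarrow> partition_on V P"
proof -
  have "p \<inter> W = {}" "W \<inter> p = {}" if "p \<in> P" for p
    using assms(4) that by blast+
  then have "disjoint (insert W P) \<longleftrightarrow> disjoint P"
    by (simp add: disjoint_def)
  moreover have "\<Union>(insert W P) = W \<union> V \<longleftrightarrow> \<Union>P = V"
    using assms(1,4) by auto
  ultimately show ?thesis using assms(2) by (auto simp: partition_on_def)
qed

lemma filter_image_eq:
  "(\<And>p. Q (f p) \<longleftrightarrow> Q' p) \<Longrightarrow> {p \<in> f ` P. Q p} = f ` {p \<in> P. Q' p}"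
  by auto

section \<open>What an insertion within one row preserves: matching, counts, balance and
  \<open>psi\<close>\<close>

context
  fixes A :: array and u v :: vertex and i :: nat and M :: "(nat \<times> nat) set"
  assumes row_u: "row u = i" and row_v: "row v = i"
    and pos_v: "pos v \<le> num A (row v) (col v)"
    and pos_u: "pos u \<le> add_cell v (num A) (row u) (col u)"
begin

private abbreviation "\<sigma> \<equiv> skip2 u v"
private abbreviation "B \<equiv> ins_pair M u v A"

lemma vertices_ins_pair: "vertices B = {u, skip u v} \<union> \<sigma> ` vertices A"
  using below_add_cell[of u "add_cell v (num A)"] below_add_cell[of v "num A"] pos_u pos_v
  by (simp add: vertices_eq_below image_image skip2_def)

lemma well_paired_ins_pair: "well_paired B \<longleftrightarrow> well_paired A"
proof -
  have W: "{u, skip u v} \<inter> \<sigma> ` X = {}" for X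
    using range_skip2[of u v] by blast
  have "\<Union>((`) \<sigma> ` pairing A) \<inter> {u, skip u v} = {}"
    using W[of "\<Union>(pairing A)"] by blast
  then have "partition_on (vertices B) (pairing B) \<longleftrightarrow>
      partition_on (\<sigma> ` vertices A) ((`) \<sigma> ` pairing A)"
    unfolding vertices_ins_pair ins_pair_sel
    by (intro partition_on_insert_block W notin_skip2_image) auto
  also have "\<dots> \<longleftrightarrow> partition_on (vertices A) (pairing A)"
    by (intro partition_on_image inj_skip2)
  moreover have "card (\<sigma> ` p) = card p" for p
    by (intro card_image inj_on_subset[OF inj_skip2]) simp
  moreover have "card {u, skip u v} = 2"
    using skip_neq[of u v] by simp
  ultimately show ?thesis by (simp add: well_paired_def)
qed

lemma card_image_blocks: "card ((`) \<sigma> ` P) = card P"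
  by (intro card_image inj_on_subset[OF inj_image_blocks[OF inj_skip2]]) simp

lemma card_pure_ins_pair:
  assumes "finite (pairing A)"
  shows "card {p \<in> pairing B. \<forall>w\<in>p. row w = k} =
    card {p \<in> pairing A. \<forall>w\<in>p. row w = k} + (if k = i then 1 else 0)"
proof -
  let ?P = "{p \<in> pairing A. \<forall>w\<in>p. row w = k}"
  have "{p \<in> (`) \<sigma> ` pairing A. \<forall>w\<in>p. row w = k} = (`) \<sigma> ` ?P"
    by (rule filter_image_eq) simp
  moreover have "{p \<in> pairing B. \<forall>w\<in>p. row w = k} = (if k = i then {{u, skip u v}} else {}) \<union>
      {p \<in> (`) \<sigma> ` pairing A. \<forall>w\<in>p. row w = k}"
    using row_u row_v by auto
  ultimately have *: "{p \<in> pairing B. \<forall>w\<in>p. row w = k} =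
      (if k = i then insert {u, skip u v} ((`) \<sigma> ` ?P) else (`) \<sigma> ` ?P)"
    by simp
  have "finite ((`) \<sigma> ` ?P)" using assms by simp
  then show ?thesis
    unfolding * using card_image_blocks[of ?P] notin_skip2_image[of u v ?P]
    by (cases "k = i") (simp_all del: image_eqI)
qed

lemma card_between_ins_pair:
  assumes "k \<noteq> k'"
  shows "card {p \<in> pairing B. (\<exists>a\<in>p. row a = k) \<and> (\<exists>b\<in>p. row b = k')} =
    card {p \<in> pairing A. (\<exists>a\<in>p. row a = k) \<and> (\<exists>b\<in>p. row b = k')}"
proof -
  have "{p \<in> pairing B. (\<exists>a\<in>p. row a = k) \<and> (\<exists>b\<in>p. row b = k')} =
      {p \<in> (`) \<sigma> ` pairing A. (\<exists>a\<in>p. row a = k) \<and> (\<exists>b\<in>p. row b = k')}"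
    using row_u row_v assms by auto
  also have "\<dots> = (`) \<sigma> ` {p \<in> pairing A. (\<exists>a\<in>p. row a = k) \<and> (\<exists>b\<in>p. row b = k')}"
    by (rule filter_image_eq) simp
  finally show ?thesis by (simp only: card_image_blocks)
qed

lemma mixed_pairs_ins_pair: "mixed_pairs B = (`) \<sigma> ` mixed_pairs A"
proof -
  have "mixed_pairs B = {p \<in> (`) \<sigma> ` pairing A. \<exists>a\<in>p. \<exists>b\<in>p. row a \<noteq> row b}"
    using row_u row_v by (auto simp: mixed_pairs_def)
  also have "\<dots> = (`) \<sigma> ` mixed_pairs A"
    unfolding mixed_pairs_def by (rule filter_image_eq) simp
  finally show ?thesis .
qed

text \<open>The new pair lies in one row and is therefore not mixed, and the renumbering keeps rows
  and columns. So both sides of each balance equation count corresponding objects before and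
  after.\<close>

lemma balanced_ins_pair: "balanced n K B \<longleftrightarrow> balanced n K A"
proof -
  have "card {w \<in> mixed_vertices B. row w = k \<and> col w = j} =
      card {w \<in> mixed_vertices A. row w = k \<and> col w = j}" for k j
  proof -
    have "mixed_vertices B = \<sigma> ` mixed_vertices A"
      by (simp add: mixed_vertices_def mixed_pairs_ins_pair image_Union)
    moreover have "{w \<in> \<sigma> ` mixed_vertices A. row w = k \<and> col w = j} =
        \<sigma> ` {w \<in> mixed_vertices A. row w = k \<and> col w = j}"
      by (rule filter_image_eq) simp
    moreover have "inj_on \<sigma> X" for X by (rule inj_on_subset[OF inj_skip2]) simp
    ultimately show ?thesis by (simp add: card_image)
  qed
  moreover have "card {p \<in> mixed_pairs B. \<exists>a b. p = {a, b} \<and> row a = k \<and> col b = j} =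
      card {p \<in> mixed_pairs A. \<exists>a b. p = {a, b} \<and> row a = k \<and> col b = j}" for k j
  proof -
    have *: "(\<exists>a b. \<sigma> ` p = {a, b} \<and> row a = k \<and> col b = j) \<longleftrightarrow>
        (\<exists>a b. p = {a, b} \<and> row a = k \<and> col b = j)" for p
    proof
      assume "\<exists>a b. \<sigma> ` p = {a, b} \<and> row a = k \<and> col b = j"
      then obtain a b where ab: "\<sigma> ` p = {a, b}" "row a = k" "col b = j" by blast
      \<comment> \<open>Both members of the pair lie in an image under the renumbering, so they can
        be pulled back.\<close>
      then obtain a' b' where eq: "a = \<sigma> a'" "b = \<sigma> b'" by blast
      with ab have "\<sigma> ` p = \<sigma> ` {a', b'}" by simp
      then have "p = {a', b'}" by (simp only: inj_image_eq_iff[OF inj_skip2])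
      moreover have "row a' = k" "col b' = j" using ab eq by simp_all
      ultimately show "\<exists>a b. p = {a, b} \<and> row a = k \<and> col b = j" by blast
    next
      assume "\<exists>a b. p = {a, b} \<and> row a = k \<and> col b = j"
      then obtain a b where "p = {a, b}" "row a = k" "col b = j" by blast
      then have "\<sigma> ` p = {\<sigma> a, \<sigma> b}" "row (\<sigma> a) = k" "col (\<sigma> b) = j" by simp_all
      then show "\<exists>a b. \<sigma> ` p = {a, b} \<and> row a = k \<and> col b = j" by blast
    qed
    show ?thesis
      unfolding mixed_pairs_ins_pair by (subst filter_image_eq, rule *) (rule card_image_blocks)
  qed
  ultimately show ?thesis by (simp add: balanced_def)
qed

text \<open>At an unmarked column \<open>psi\<close> sees only the last vertex and the column of its
  partner. If the last vertex is old, it is the renumbered old last vertex, and its partner is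
  renumbered within the same column.\<close>

lemma psi_ins_pair:
  assumes "well_paired A" "(k, j) \<in> M \<longleftrightarrow> (k, j) \<in> marked A"
    and last: "(k, j) \<notin> M \<Longrightarrow> rightmost B k j \<notin> {u, skip u v}"
  shows "psi B k j = psi A k j"
proof (cases "(k, j) \<in> M \<or> num B k j = 0")
  case True
  then show ?thesis
    using assms(2)
    by (auto simp: psi_def marked_cols_def nonempty_cols_def add_cell_def split: if_splits)
next
  case False
  let ?r = "rightmost A k j"
  have "rightmost B k j \<in> vertices B"
    using False by (simp add: rightmost_def vertices_def)
  with last False obtain w where w: "w \<in> vertices A" "rightmost B k j = \<sigma> w"
    unfolding vertices_ins_pair by blast
  have rc: "row w = k" "col w = j"
    using arg_cong[OF w(2), of row] arg_cong[OF w(2), of col] by (simp_all add: rightmost_def)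
  then have pw: "pos w < num A k j"
    using w(1) by (simp add: vertices_eq_below below_def)
  \<comment> \<open>The renumbering shifts \<open>w\<close> by at most the number of vertices added
    to the cell. Since the image is last, the shift attains this bound and \<open>w\<close> was last
    before.\<close>
  have "?r = w"
  proof -
    have "pos (\<sigma> w) = num B k j - 1"
      by (subst w(2)[symmetric]) (simp add: rightmost_def)
    then have "pos w = num A k j - 1"
      using pos_u pos_v pw rc
      by (auto simp: skip2_def pos_skip add_cell_def split: if_splits)
    then show ?thesis
      using rc by (intro vertex_eqI) (simp_all add: rightmost_def)
  qed
  obtain w' where w': "{w, w'} \<in> pairing A" "w \<noteq> w'" "partner A w = w'"
    using well_paired_partnerE[OF assms(1) w(1)] .
  have "{\<sigma> w, \<sigma> w'} = \<sigma> ` {w, w'}" by simp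
  then have "{\<sigma> w, \<sigma> w'} \<in> pairing B" using w'(1) by (metis ins_pair_sel(3) image_eqI insertI2)
  moreover have "\<sigma> w \<noteq> \<sigma> w'" using w'(2) inj_skip2 by (metis injD)
  moreover have "well_paired B" using assms(1) by (simp only: well_paired_ins_pair)
  ultimately have "partner B (rightmost B k j) = \<sigma> w'"
    unfolding w(2) by (intro partner_eq)
  then show ?thesis
    using False assms(2) pw w'(3) \<open>?r = w\<close>
    by (auto simp: psi_def marked_cols_def nonempty_cols_def simp del: ins_pair_sel(1))
qed

end


subsection \<open>The forest condition\<close>

definition psi_rel :: "array \<Rightarrow> nat \<Rightarrow> (nat \<times> nat) set" where
  "psi_rel A i = {(j, k). psi A i j = Some k}"

lemma psi_iter_eq_Some_iff: "psi_iter A i t j = Some m \<longleftrightarrow> (j, m) \<in> psi_rel A i ^^ t"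
proof (induction t arbitrary: m)
  case (Suc t)
  have "psi_iter A i (Suc t) j = Option.bind (psi_iter A i t j) (psi A i)"
    by (simp add: psi_iter_def)
  then show ?case
    by (cases "psi_iter A i t j") (auto simp: relcomp_unfold Suc.IH[symmetric], auto simp: psi_rel_def)
qed (auto simp: psi_iter_def)

lemma Domain_psi_rel: "Domain (psi_rel A i) = nonempty_cols A i - marked_cols A i"
  by (auto simp: psi_rel_def psi_def split: if_splits)

lemma single_valued_psi_rel: "single_valued (psi_rel A i)"
  by (auto simp: single_valued_def psi_rel_def)

text \<open>Reflexive closure may replace iteration with \<open>t \<ge> 1\<close>: the starting
  column is unmarked, so a path of length zero never ends in a root.\<close>

lemma forest_iff:
  "forest n A \<longleftrightarrow> (\<forall>i\<in>{1..n}. \<forall>j\<in>Domain (psi_rel A i).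
     \<exists>m\<in>marked_cols A i. (j, m) \<in> (psi_rel A i)\<^sup>*)"
proof -
  have "(\<exists>t\<ge>1. \<exists>m\<in>marked_cols A i. psi_iter A i t j = Some m) \<longleftrightarrow>
      (\<exists>m\<in>marked_cols A i. (j, m) \<in> (psi_rel A i)\<^sup>*)"
    if "j \<in> Domain (psi_rel A i)" for i j
  proof
    assume "\<exists>t\<ge>1. \<exists>m\<in>marked_cols A i. psi_iter A i t j = Some m"
    then show "\<exists>m\<in>marked_cols A i. (j, m) \<in> (psi_rel A i)\<^sup>*"
      by (auto simp: psi_iter_eq_Some_iff dest: relpow_imp_rtrancl)
  next
    assume "\<exists>m\<in>marked_cols A i. (j, m) \<in> (psi_rel A i)\<^sup>*"
    then obtain m t where m: "m \<in> marked_cols A i" "(j, m) \<in> psi_rel A i ^^ t"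
      by (auto dest: rtrancl_imp_relpow)
    moreover have "j \<notin> marked_cols A i" using that by (auto simp: Domain_psi_rel)
    ultimately have "t \<noteq> 0" by (cases t) auto
    then show "\<exists>t\<ge>1. \<exists>m\<in>marked_cols A i. psi_iter A i t j = Some m"
      using m by (metis One_nat_def Suc_leI gr0I psi_iter_eq_Some_iff)
  qed
  then show ?thesis by (simp add: forest_def Domain_psi_rel)
qed

text \<open>Only \<open>x\<close> and \<open>y\<close> are reachable from \<open>x\<close>, and both
  are unmarked. The case \<open>x = y\<close>, a loop, is included.\<close>

lemma forest_no_2cycle:
  assumes "forest n A" "i \<in> {1..n}" "psi A i x = Some y" "psi A i y = Some x"
  shows False
proof -
  have "z = x \<or> z = y" if "(x, z) \<in> (psi_rel A i)\<^sup>*" for z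
    using that
  proof induction
    case (step z z')
    then show ?case using assms(3,4) by (auto simp: psi_rel_def)
  qed simp
  moreover have "x \<in> Domain (psi_rel A i)" "y \<in> Domain (psi_rel A i)"
    using assms(3,4) by (auto simp: psi_rel_def)
  moreover from this(1) obtain m where "m \<in> marked_cols A i" "(x, m) \<in> (psi_rel A i)\<^sup>*"
    using assms(1,2) unfolding forest_iff by blast
  ultimately show False by (auto simp: Domain_psi_rel)
qed

text \<open>Of two paths with the same start in a functional graph, one continues the other; roots
  have no outgoing edge, so the ends agree.\<close>

lemma root_unique:
  assumes "(j, m) \<in> (psi_rel A i)\<^sup>*" "(j, m') \<in> (psi_rel A i)\<^sup>*"
    and "m \<in> marked_cols A i" "m' \<in> marked_cols A i"
  shows "m = m'"
proof -
  have "m \<notin> Domain (psi_rel A i)" "m' \<notin> Domain (psi_rel A i)"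
    using assms(3,4) by (auto simp: Domain_psi_rel)
  then show ?thesis
    using single_valued_confluent[OF single_valued_psi_rel assms(1,2)]
    by (auto elim: converse_rtranclE)
qed

text \<open>The root \<open>x\<close> is hung below \<open>y\<close>. The result is a forest on the
  remaining roots exactly if the old graph was a forest and \<open>y\<close> belongs to a tree other
  than that of \<open>x\<close>; otherwise the new edge closes a cycle.\<close>

lemma functional_graph_add_edge:
  assumes sv: "single_valued E" and E: "x \<notin> Domain E" "M \<inter> Domain E = {}" "x \<in> M"
  shows "(\<forall>j\<in>Domain (insert (x, y) E). \<exists>m\<in>M - {x}. (j, m) \<in> (insert (x, y) E)\<^sup>*) \<longleftrightarrow>
    (\<forall>j\<in>Domain E. \<exists>m\<in>M. (j, m) \<in> E\<^sup>*) \<and> (\<exists>m\<in>M - {x}. (y, m) \<in> E\<^sup>*)"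
    (is "?L \<longleftrightarrow> ?R")
proof
  let ?F = "insert (x, y) E"
  have EF: "(a, b) \<in> ?F\<^sup>*" if "(a, b) \<in> E\<^sup>*" for a b
    using that rtrancl_mono[of E ?F] by blast
  {
    assume L: ?L
    \<comment> \<open>A path in the new graph is cut where it first uses the new edge. It then ends
      in \<open>x\<close>, which is a root of the old graph.\<close>
    have cut: "\<exists>m\<in>M. (j, m) \<in> E\<^sup>*" if "(j, m) \<in> ?F\<^sup>*" "m \<in> M" for j m
      using that
    proof (induction rule: converse_rtrancl_induct)
      case (step a b)
      then show ?case using E(3) by (auto intro: converse_rtrancl_into_rtrancl)
    qed auto
    obtain m where m: "m \<in> M" "m \<noteq> x" "(x, m) \<in> ?F\<^sup>*" using L by auto
    then have ym: "(y, m) \<in> ?F\<^sup>*" using E(1) by (auto elim: converse_rtranclE)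
    obtain r where r: "r \<in> M" "(y, r) \<in> E\<^sup>*" using cut[OF ym m(1)] by auto
    \<comment> \<open>If \<open>y\<close> led back to \<open>x\<close>, there would be a cycle
      through \<open>x\<close>, and everything reachable from \<open>x\<close> would lead back to
      \<open>x\<close>. The root \<open>m\<close> is reachable but has no outgoing edge.\<close>
    have "r \<noteq> x"
    proof
      assume "r = x"
      have "(m, x) \<in> ?F\<^sup>*"
        using m(3)
      proof induction
        case (step a b)
        show ?case
        proof (cases "a = x")
          case True
          then have "b = y" using step.hyps E(1) by auto
          then show ?thesis using EF[OF r(2)] \<open>r = x\<close> by simp
        next
          case False
          then obtain c where c: "(a, c) \<in> ?F" "(c, x) \<in> ?F\<^sup>*"
            using step.IH by (auto elim: converse_rtranclE)
          then have "c = b" using step.hyps False sv by (auto dest: single_valuedD)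
          then show ?thesis using c by simp
        qed
      qed simp
      then obtain c where "(m, c) \<in> ?F" using m(2) by (auto elim: converse_rtranclE)
      then show False using m E(2) by auto
    qed
    moreover have "\<forall>j\<in>Domain E. \<exists>m\<in>M. (j, m) \<in> E\<^sup>*"
    proof
      fix j assume "j \<in> Domain E"
      then obtain m where "m \<in> M" "(j, m) \<in> ?F\<^sup>*" using L by auto
      then show "\<exists>m\<in>M. (j, m) \<in> E\<^sup>*" using cut by blast
    qed
    ultimately show ?R using r by blast
  }
  {
    assume R: ?R
    then obtain m where m: "m \<in> M - {x}" "(y, m) \<in> E\<^sup>*" by blast
    have xm: "(x, m) \<in> ?F\<^sup>*"
      using EF[OF m(2)] by (auto intro: converse_rtrancl_into_rtrancl)
    show ?L
    proof
      fix j assume "j \<in> Domain ?F"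
      then consider "j = x" | m' where "m' \<in> M" "(j, m') \<in> E\<^sup>*" using R by auto
      then show "\<exists>m\<in>M - {x}. (j, m) \<in> ?F\<^sup>*"
      proof cases
        case 1
        then show ?thesis using xm m by blast
      next
        case 2
        then show ?thesis
          using xm m EF[OF 2(2)] by (cases "m' = x") (auto intro: rtrancl_trans)
      qed
    qed
  }
qed

section \<open>Effect of an inserted pair on the forest condition\<close>

lemma rightmost_eq_iff:
  "rightmost A i j = w \<longleftrightarrow> row w = i \<and> col w = j \<and> pos w = num A i j - 1"
  by (auto simp: rightmost_def intro: vertex_eqI)

definition unmarked_last :: "array \<Rightarrow> vertex \<Rightarrow> bool" where
  "unmarked_last A u \<longleftrightarrow> rightmost A (row u) (col u) = u \<and> (row u, col u) \<notin> marked A"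

lemma psi_unmarked_last:
  assumes "well_paired A" "{u, w} \<in> pairing A" "u \<noteq> w" "unmarked_last A u"
  shows "psi A (row u) (col u) = Some (col w)"
proof -
  have "u \<in> vertices A" using assms(1,2) by (auto simp: well_paired_def partition_on_def)
  then have "num A (row u) (col u) \<noteq> 0" by (simp add: vertices_eq_below below_def)
  then show ?thesis
    using assms partner_eq[OF assms(1-3)]
    by (simp add: psi_def nonempty_cols_def marked_cols_def unmarked_last_def)
qed

text \<open>With the marks kept and neither new vertex critical, the last vertex of every unmarked
  nonempty cell is an old one, so \<open>psi\<close> does not change at all.\<close>

lemma forest_ins_pair_slots:
  assumes "row u = row v" "pos v \<le> num A (row v) (col v)"
    "pos u \<le> add_cell v (num A) (row u) (col u)" "well_paired A"
    and "\<not> unmarked_last (ins_pair (marked A) u v A) u"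
    and "\<not> unmarked_last (ins_pair (marked A) u v A) (skip u v)"
  shows "forest n (ins_pair (marked A) u v A) \<longleftrightarrow> forest n A"
proof -
  let ?B = "ins_pair (marked A) u v A"
  have "psi ?B k j = psi A k j" for k j
  proof (rule psi_ins_pair[OF assms(1) refl assms(2,3,4) refl])
    assume k: "(k, j) \<notin> marked A"
    show "rightmost ?B k j \<notin> {u, skip u v}"
    proof
      assume "rightmost ?B k j \<in> {u, skip u v}"
      then obtain w where w: "w \<in> {u, skip u v}" "rightmost ?B k j = w" by blast
      then have "row w = k" "col w = j" by (simp_all only: rightmost_eq_iff)
      with w k have "unmarked_last ?B w" by (simp add: unmarked_last_def)
      with w assms(5,6) show False by blast
    qed
  qed
  then have "psi_rel ?B k = psi_rel A k" for k by (simp add: psi_rel_def)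
  then show ?thesis by (simp add: forest_iff marked_cols_def)
qed

text \<open>A vertex inserted at a slot never becomes the last one of an unmarked cell.\<close>

definition slots :: "nat \<Rightarrow> (nat \<times> nat) set \<Rightarrow> nat \<Rightarrow> (nat \<Rightarrow> nat \<Rightarrow> nat) \<Rightarrow> vertex set" where
  "slots K M i f = {w. row w = i \<and> col w \<in> {1..K} \<and>
     pos w < f i (col w) + (if (i, col w) \<in> M then 1 else 0)}"

text \<open>The mark of \<open>x\<close> is removed and \<open>u\<close> becomes the last vertex of
  that cell, so \<open>u\<close> creates the edge from \<open>x\<close> to \<open>col v\<close>. If
  \<open>v\<close> is critical too, the two edges form a cycle; otherwise this edge is the only
  change and \<open>functional_graph_add_edge\<close> decides.\<close>

lemma forest_ins_pair_root:
  fixes A i x v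
  defines "u \<equiv> (i, x, num A i x)" and "M \<equiv> marked A - {(i, x)}"
  defines "B \<equiv> ins_pair M u v A"
  assumes v: "row v = i" "col v \<in> {1..K}" "pos v \<le> num A i (col v)"
    and x: "(i, x) \<in> marked A" "col v \<noteq> x" and i: "i \<in> {1..n}" and wp: "well_paired A"
  shows "forest n B \<longleftrightarrow>
    forest n A \<and> v \<in> slots K (marked A) i (num A) \<and> (col v, x) \<notin> (psi_rel A i)\<^sup>*"
proof -
  let ?y = "col v"
  have u: "row u = row v" "row v = i" "col u = x" "pos u = num A i x"
    using v by (simp_all add: u_def)
  have p: "pos v \<le> num A (row v) (col v)" "pos u \<le> add_cell v (num A) (row u) (col u)"
    using v u by (simp_all add: add_cell_def)
  have sk: "skip u v = v" using u x by (intro vertex_eqI) (simp_all add: pos_skip)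
  have wpB: "well_paired B"
    unfolding B_def using well_paired_ins_pair[OF _ _ p] u wp by simp
  have uv: "{u, v} \<in> pairing B" "u \<noteq> v" using sk u x by (auto simp: B_def)
  \<comment> \<open>The position \<open>num A i x\<close> is the place after all old vertices of the
    cell, and \<open>v\<close> is in a different column.\<close>
  have last_u: "unmarked_last B u"
    using u x by (auto simp: unmarked_last_def rightmost_eq_iff B_def M_def add_cell_def)
  have psi_x: "psi B i x = Some ?y"
    using psi_unmarked_last[OF wpB uv last_u] u by simp
  have last_v: "unmarked_last B v \<longleftrightarrow> v \<notin> slots K (marked A) i (num A)"
    using u v x
      by (auto simp: unmarked_last_def rightmost_eq_iff B_def M_def add_cell_def slots_def)
  show ?thesis
  proof (cases "unmarked_last B v")
    case True
    have "psi B i ?y = Some x"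
      using psi_unmarked_last[OF wpB _ _ True, of u] uv u by (simp add: insert_commute)
    then have "\<not> forest n B" using forest_no_2cycle[OF _ i psi_x] by blast
    then show ?thesis using True last_v by blast
  next
    case False
    have psi_eq: "psi B k j = psi A k j" if "(k, j) \<noteq> (i, x)" for k j
      unfolding B_def
    proof (rule psi_ins_pair[OF u(1) refl p wp], goal_cases)
      case 1
      then show ?case using that by (simp add: M_def)
    next
      case 2
      show ?case
      proof
        assume "rightmost (ins_pair M u v A) k j \<in> {u, skip u v}"
        then have "rightmost B k j = u \<or> rightmost B k j = v" by (simp add: sk B_def)
        then have "rightmost B k j = v" "k = row v" "j = col v"
          using u that by (auto simp: rightmost_eq_iff)
        then show False using False 2 by (simp add: unmarked_last_def B_def)
      qed
    qed
    have psiA_x: "psi A i x = None" using x by (simp add: psi_def marked_cols_def)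
    have other: "psi_rel B k = psi_rel A k" if "k \<noteq> i" for k
      using psi_eq[of k] that by (simp add: psi_rel_def)
    have this_row: "psi_rel B i = insert (x, ?y) (psi_rel A i)"
    proof -
      have "(j, k) \<in> psi_rel B i \<longleftrightarrow> (j, k) \<in> insert (x, ?y) (psi_rel A i)" for j k
        using psi_eq[of i j] psi_x psiA_x by (cases "j = x") (auto simp: psi_rel_def)
      then show ?thesis by auto
    qed
    have marks: "marked_cols B k = (if k = i then marked_cols A i - {x} else marked_cols A k)" for k
      by (auto simp: marked_cols_def B_def M_def)
    \<comment> \<open>The forest condition for a single row. Splitting off row \<open>i\<close>
      leaves rows whose graph and marks are untouched.\<close>
    define F where "F X k \<longleftrightarrow> (\<forall>j\<in>Domain (psi_rel X k).
        \<exists>m\<in>marked_cols X k. (j, m) \<in> (psi_rel X k)\<^sup>*)" for X k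
    have F_split: "forest n X \<longleftrightarrow> F X i \<and> (\<forall>k\<in>{1..n} - {i}. F X k)" for X
      unfolding forest_iff F_def[symmetric] using i by (metis DiffI Diff_iff singletonD)
    have "(\<forall>k\<in>{1..n} - {i}. F B k) \<longleftrightarrow> (\<forall>k\<in>{1..n} - {i}. F A k)"
      by (rule ball_cong) (simp_all add: F_def other marks)
    moreover have "F B i \<longleftrightarrow> F A i \<and>
        (\<exists>m\<in>marked_cols A i - {x}. (?y, m) \<in> (psi_rel A i)\<^sup>*)"
      unfolding F_def this_row marks
      using functional_graph_add_edge[OF single_valued_psi_rel, of x A i "marked_cols A i" ?y] x
      by (simp add: Domain_psi_rel marked_cols_def)
    ultimately have "forest n B \<longleftrightarrow> forest n A \<and>
        (\<exists>m\<in>marked_cols A i - {x}. (?y, m) \<in> (psi_rel A i)\<^sup>*)"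
      unfolding F_split by argo
    \<comment> \<open>The slot of \<open>v\<close> lies in a cell that is nonempty or marked, so its
      column has a root, and only one. Having a root other than \<open>x\<close> thus means not
      leading to \<open>x\<close>.\<close>
    moreover have "(\<exists>m\<in>marked_cols A i - {x}. (?y, m) \<in> (psi_rel A i)\<^sup>*) \<longleftrightarrow>
        (?y, x) \<notin> (psi_rel A i)\<^sup>*" if forest: "forest n A"
    proof -
      have "?y \<in> Domain (psi_rel A i) \<or> ?y \<in> marked_cols A i"
        using False last_v
        by (auto simp: Domain_psi_rel slots_def marked_cols_def nonempty_cols_def split: if_splits)
      then obtain r where r: "r \<in> marked_cols A i" "(?y, r) \<in> (psi_rel A i)\<^sup>*"
        using forest i unfolding forest_iff by blast
      have "x \<in> marked_cols A i" using x by (simp add: marked_cols_def)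
      then show ?thesis using r root_unique[of ?y x A i] by blast
    qed
    ultimately show ?thesis using False last_v by blast
  qed
qed



subsection \<open>Removing a pair\<close>

definition cells_ok :: "nat \<Rightarrow> nat \<Rightarrow> (nat \<Rightarrow> nat) \<Rightarrow> (nat \<Rightarrow> nat \<Rightarrow> nat) \<Rightarrow> array \<Rightarrow> bool" where
  "cells_ok n K q s A \<longleftrightarrow>
     (\<forall>i j. (i, j) \<notin> {1..n} \<times> {1..K} \<longrightarrow> num A i j = 0) \<and>
     (\<forall>i\<in>{1..n}. (\<Sum>j=1..K. num A i j) = 2 * q i + row_sum n s i) \<and>
     well_paired A \<and>
     (\<forall>i\<in>{1..n}. card {p \<in> pairing A. \<forall>v\<in>p. row v = i} = q i) \<and>
     (\<forall>i\<in>{1..n}. \<forall>k\<in>{1..n}. i < k \<longrightarrow>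
        card {p \<in> pairing A. (\<exists>u\<in>p. row u = i) \<and> (\<exists>v\<in>p. row v = k)} = s i k)"

definition marks_ok :: "nat \<Rightarrow> nat \<Rightarrow> (nat \<Rightarrow> nat) \<Rightarrow> (nat \<times> nat) set \<Rightarrow> bool" where
  "marks_ok n K R M \<longleftrightarrow> (\<forall>i\<in>{1..n}. 1 \<le> R i \<and> R i \<le> K) \<and> M \<subseteq> {1..n} \<times> {1..K} \<and>
     (\<forall>i\<in>{1..n}. card {j. (i, j) \<in> M} = R i)"

text \<open>The conditions are regrouped so that those on the marks stand apart: the two kinds of
  deletion treat the cells alike but the marks differently.\<close>

lemma proper_array_iff:
  "proper_array n K R q s A \<longleftrightarrow>
     marks_ok n K R (marked A) \<and> cells_ok n K q s A \<and> balanced n K A \<and> forest n A"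
  by (auto simp: proper_array_def paired_array_def marks_ok_def cells_ok_def well_paired_def
      marked_cols_def)

lemma vertices_subset_grid:
  assumes "\<forall>i j. (i, j) \<notin> {1..n} \<times> {1..K} \<longrightarrow> num A i j = 0"
    and "\<And>i. i \<in> {1..n} \<Longrightarrow> (\<Sum>j=1..K. num A i j) \<le> N"
  shows "vertices A \<subseteq> {1..n} \<times> {1..K} \<times> {..<N}"
proof
  fix w assume "w \<in> vertices A"
  then obtain i j l where w: "w = (i, j, l)" "l < num A i j" by (auto simp: vertices_def)
  then have ij: "i \<in> {1..n}" "j \<in> {1..K}" using assms(1) by (metis mem_Sigma_iff not_less0)+
  then have "num A i j \<le> (\<Sum>j=1..K. num A i j)" by (intro member_le_sum) auto
  with w ij assms(2)[OF ij(1)] show "w \<in> {1..n} \<times> {1..K} \<times> {..<N}" by auto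
qed

lemma finite_vertices:
  assumes "\<forall>i j. (i, j) \<notin> {1..n} \<times> {1..K} \<longrightarrow> num A i j = 0"
  shows "finite (vertices A)"
proof (rule finite_subset[OF vertices_subset_grid[OF assms]])
  show "(\<Sum>j=1..K. num A i j) \<le> (\<Sum>i=1..n. \<Sum>j=1..K. num A i j)" if "i \<in> {1..n}" for i
    using that by (intro member_le_sum) auto
qed auto

lemma finite_pairing:
  assumes "well_paired A" "finite (vertices A)"
  shows "finite (pairing A)"
  using assms by (auto simp: well_paired_def intro: finite_elements)

lemma sum_add_cell:
  assumes "col w \<in> {1..K}"
  shows "(\<Sum>j=1..K. add_cell w f k j) = (\<Sum>j=1..K. f k j) + (if k = row w then 1 else 0)"
proof -
  have "(\<Sum>j=1..K. add_cell w f k j) =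
      (\<Sum>j=1..K. f k j + (if j = col w then if k = row w then 1 else 0 else 0))"
    by (rule sum.cong) (auto simp: add_cell_def)
  then show ?thesis using assms by (simp add: sum.distrib)
qed

lemma cells_ok_ins_pair:
  assumes "row u = i" "row v = i" "pos v \<le> num A (row v) (col v)"
    and "pos u \<le> add_cell v (num A) (row u) (col u)"
    and i: "i \<in> {1..n}" "col u \<in> {1..K}" "col v \<in> {1..K}"
  shows "cells_ok n K (q(i := Suc (q i))) s (ins_pair M u v A) \<longleftrightarrow> cells_ok n K q s A"
proof -
  let ?B = "ins_pair M u v A"
  have wp: "well_paired ?B \<longleftrightarrow> well_paired A"
    using assms by (intro well_paired_ins_pair)
  have grid: "(\<forall>i j. (i, j) \<notin> {1..n} \<times> {1..K} \<longrightarrow> num ?B i j = 0) \<longleftrightarrow>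
      (\<forall>i j. (i, j) \<notin> {1..n} \<times> {1..K} \<longrightarrow> num A i j = 0)"
    using assms by (auto simp: add_cell_def)
  have sums: "(\<Sum>j=1..K. num ?B k j) = (\<Sum>j=1..K. num A k j) + (if k = i then 2 else 0)" for k
    unfolding ins_pair_sel sum_add_cell[OF i(2)] sum_add_cell[OF i(3)] using assms(1,2) by simp
  have pure: "card {p \<in> pairing ?B. \<forall>w\<in>p. row w = k} =
      card {p \<in> pairing A. \<forall>w\<in>p. row w = k} + (if k = i then 1 else 0)" if "finite (pairing A)" for k
    using card_pure_ins_pair[OF assms(1-4) that] .
  have mixed: "card {p \<in> pairing ?B. (\<exists>a\<in>p. row a = k) \<and> (\<exists>b\<in>p. row b = k')} =
      card {p \<in> pairing A. (\<exists>a\<in>p. row a = k) \<and> (\<exists>b\<in>p. row b = k')}" if "k < k'" for k k'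
    using card_between_ins_pair[OF assms(1-4)] that by simp
  show ?thesis
  \<comment> \<open>The count of pairs within a row needs a finite pairing, which follows from these
    two conditions. If one of them fails, both sides of the equivalence are false.\<close>
  proof (cases "well_paired A \<and> (\<forall>i j. (i, j) \<notin> {1..n} \<times> {1..K} \<longrightarrow> num A i j = 0)")
    case True
    then have fin: "finite (pairing A)" by (metis finite_pairing finite_vertices)
    show ?thesis
      unfolding cells_ok_def wp grid sums pure[OF fin] using i(1)
      by (simp add: mixed del: ins_pair_sel cong: conj_cong) auto
  next
    case False
    then show ?thesis unfolding cells_ok_def wp grid by blast
  qed
qed

text \<open>Inverse of the insertion: the counts are lowered and the remaining pairs are pulled back
  along \<open>skip2 u v\<close>. The marks \<open>M\<close> of the smaller array may be prescribed
  at will.\<close>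

lemma ins_pair_surj:
  assumes wp: "well_paired B" and uw: "{u, w} \<in> pairing B" "u \<noteq> w" and rows: "row u = row w"
  obtains A v where "w = skip u v" "row v = row w" "col v = col w"
    "B = ins_pair (marked B) u v A" "marked A = M"
    "pos v \<le> num A (row v) (col v)" "pos u \<le> add_cell v (num A) (row u) (col u)"
proof -
  obtain v where v: "w = skip u v" using skip_surj[of w u] uw(2) by blast
  define A where "A = Array
    (\<lambda>i j. num B i j - (if i = row u \<and> j = col u then 1 else 0) -
      (if i = row v \<and> j = col v then 1 else 0)) M
    ((\<lambda>p. skip2 u v -` p) ` (pairing B - {{u, w}}))"
  have rc: "row v = row w" "col v = col w" using v by simp_all
  have "u \<in> vertices B" "w \<in> vertices B"
    using wp uw by (auto simp: well_paired_def partition_on_def)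
  then have pu: "pos u < num B (row u) (col u)" and pw: "pos w < num B (row w) (col w)"
    by (simp_all add: vertices_eq_below below_def)
  \<comment> \<open>If both vertices share a cell, one is subtracted from its count twice; truncated
    subtraction loses nothing because the cell has two distinct vertices.\<close>
  have two: "2 \<le> num B (row u) (col u)" if "col u = col w"
  proof (rule ccontr)
    assume "\<not> 2 \<le> num B (row u) (col u)"
    then have "pos u = 0" "pos w = 0" using pu pw rows that by auto
    then show False using vertex_eqI[OF rows that] uw by simp
  qed
  have num: "num B = add_cell u (add_cell v (num A))"
    using pu pw two rows rc by (auto simp: fun_eq_iff add_cell_def A_def)
  \<comment> \<open>The other pairs avoid \<open>u\<close> and \<open>w\<close>, hence lie in the
    range of the renumbering, where preimage and image are inverse.\<close>
  have "skip2 u v ` (skip2 u v -` p) = p" if "p \<in> pairing B - {{u, w}}" for p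
  proof -
    have "p \<inter> {u, w} = {}"
      using that uw(1) wp disjointD[of "pairing B" p "{u, w}"]
      unfolding well_paired_def partition_on_def by blast
    then have "p \<subseteq> range (skip2 u v)" unfolding range_skip2 v by blast
    then show ?thesis by blast
  qed
  then have "(`) (skip2 u v) ` pairing A = pairing B - {{u, w}}"
    by (simp add: A_def image_image)
  then have "pairing B = insert {u, skip u v} ((`) (skip2 u v) ` pairing A)"
    using uw(1) v by auto
  then have "B = ins_pair (marked B) u v A"
    by (intro array.expand) (simp add: num[symmetric])
  moreover have "pos v \<le> num A (row v) (col v)" "pos u \<le> add_cell v (num A) (row u) (col u)"
    using pu pw unfolding num v using rows
    by (auto simp: add_cell_def pos_skip v split: if_splits)
  moreover have "marked A = M" by (simp add: A_def)
  ultimately show ?thesis using v rc by (intro that)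
qed

text \<open>Each cell offers one place to the left of each of its vertices, and the final place only
  if it is marked.\<close>

lemma card_slots:
  "card (slots K M i f) = (\<Sum>j=1..K. f i j) + card {j \<in> {1..K}. (i, j) \<in> M}"
  "finite (slots K M i f)"
proof -
  let ?g = "\<lambda>j. f i j + (if (i, j) \<in> M then 1 else 0)"
  let ?S = "SIGMA j:{1..K}. {..<?g j}"
  have "slots K M i f = (\<lambda>(j, l). (i, j, l)) ` ?S"
    by (auto simp: slots_def image_iff row_def col_def pos_def)
  moreover have "inj_on (\<lambda>(j, l). (i, j, l)) ?S" by (auto simp: inj_on_def)
  ultimately have "card (slots K M i f) = (\<Sum>j=1..K. ?g j)" and "finite (slots K M i f)"
    by (simp_all add: card_image)
  moreover have "(\<Sum>j=1..K. if (i, j) \<in> M then 1 else 0) = card {j \<in> {1..K}. (i, j) \<in> M}"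
    by (simp add: sum.inter_filter[symmetric])
  ultimately show "card (slots K M i f) = (\<Sum>j=1..K. f i j) + card {j \<in> {1..K}. (i, j) \<in> M}"
    "finite (slots K M i f)"
    by (simp_all add: sum.distrib)
qed

text \<open>An array is determined by its marks and pairing, since the pairs cover all vertices and
  these determine the counts. Both range over subsets of finite sets.\<close>

lemma finite_proper_arrays: "finite {A. proper_array n K R q s A}"
proof -
  define N where "N = (\<Sum>i=1..n. 2 * q i + row_sum n s i)"
  define V where "V = {1..n} \<times> {1..K} \<times> {..<N}"
  let ?X = "{A. proper_array n K R q s A}"
  have inj: "inj_on (\<lambda>A. (marked A, pairing A)) ?X"
  proof (rule inj_onI)
    fix A B assume A: "A \<in> ?X" and B: "B \<in> ?X"
      and eq: "(marked A, pairing A) = (marked B, pairing B)"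
    have "vertices A = \<Union>(pairing A)" "vertices B = \<Union>(pairing B)"
      using A B by (auto simp: proper_array_iff cells_ok_def well_paired_def partition_on_def)
    with eq have "vertices A = vertices B" by simp
    then have "l < num A i j \<longleftrightarrow> l < num B i j" for i j l
      by (auto simp: vertices_def set_eq_iff)
    then have "num A i j = num B i j" for i j
      by (metis less_irrefl_nat linorder_neqE_nat)
    then have "num A = num B" by (intro ext)
    with eq show "A = B" by (intro array.expand) auto
  qed
  have "(\<lambda>A. (marked A, pairing A)) ` ?X \<subseteq> Pow ({1..n} \<times> {1..K}) \<times> Pow (Pow V)"
  proof clarify
    fix A assume A: "proper_array n K R q s A"
    have "vertices A \<subseteq> V"
      unfolding V_def
    proof (rule vertices_subset_grid)
      show "\<forall>i j. (i, j) \<notin> {1..n} \<times> {1..K} \<longrightarrow> num A i j = 0"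
        using A by (simp add: proper_array_iff cells_ok_def)
      fix i assume i: "i \<in> {1..n}"
      then have "(\<Sum>j=1..K. num A i j) = 2 * q i + row_sum n s i"
        using A by (simp add: proper_array_iff cells_ok_def)
      also have "\<dots> \<le> N" unfolding N_def using i by (intro member_le_sum) auto
      finally show "(\<Sum>j=1..K. num A i j) \<le> N" .
    qed
    then show "marked A \<in> Pow ({1..n} \<times> {1..K}) \<and> pairing A \<in> Pow (Pow V)"
      using A
      by (auto simp: proper_array_iff cells_ok_def well_paired_def partition_on_def marks_ok_def)
  qed
  then have "finite ((\<lambda>A. (marked A, pairing A)) ` ?X)"
    by (rule finite_subset) (simp add: V_def)
  with inj show ?thesis by (rule finite_imageD[rotated])
qed

lemma card_ordered_pairs:
  assumes "finite P" "\<forall>p\<in>P. card p = 2"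
  shows "card {(a, b). {a, b} \<in> P \<and> a \<noteq> b} = 2 * card P"
    "finite {(a, b). {a, b} \<in> P \<and> a \<noteq> b}"
proof -
  define D where "D p = {(a, b). {a, b} = p \<and> a \<noteq> b}" for p :: "'a set"
  have two: "card (D p) = 2" "finite (D p)" if p: "p \<in> P" for p
  proof -
    from assms(2) p obtain a b where ab: "p = {a, b}" "a \<noteq> b" by (metis card_2_iff)
    then have "D p = {(a, b), (b, a)}" by (auto simp: D_def doubleton_eq_iff)
    with ab show "card (D p) = 2" "finite (D p)" by simp_all
  qed
  have eq: "{(a, b). {a, b} \<in> P \<and> a \<noteq> b} = (\<Union>p\<in>P. D p)" by (auto simp: D_def)
  have "D p \<inter> D p' = {}" if "p \<noteq> p'" for p p' using that by (auto simp: D_def)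
  then have "card (\<Union>p\<in>P. D p) = (\<Sum>p\<in>P. card (D p))"
    using assms(1) two(2) by (simp add: card_UN_disjoint)
  then show "card {(a, b). {a, b} \<in> P \<and> a \<noteq> b} = 2 * card P"
    using two(1) by (simp add: eq)
  show "finite {(a, b). {a, b} \<in> P \<and> a \<noteq> b}"
    unfolding eq using assms(1) two(2) by simp
qed



subsection \<open>The one-pair recursion\<close>

text \<open>The common generalisation of both numbers of the theorem: all \<open>R i = 1\<close>
  gives \<open>c_num\<close>, and all \<open>q i = 0\<close> gives \<open>v_num\<close>.\<close>

definition p_num :: "nat \<Rightarrow> nat \<Rightarrow> (nat \<Rightarrow> nat) \<Rightarrow> (nat \<Rightarrow> nat) \<Rightarrow> (nat \<Rightarrow> nat \<Rightarrow> nat) \<Rightarrow> nat" where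
  "p_num n K R q s = card {A. proper_array n K R q s A}"

text \<open>The set that is counted in two ways. The distinguished pair is ordered, so each pair
  within row \<open>i\<close> occurs twice.\<close>

definition pair_arrays :: "nat \<Rightarrow> nat \<Rightarrow> (nat \<Rightarrow> nat) \<Rightarrow> (nat \<Rightarrow> nat) \<Rightarrow> (nat \<Rightarrow> nat \<Rightarrow> nat) \<Rightarrow> nat \<Rightarrow>
    (array \<times> vertex \<times> vertex) set" where
  "pair_arrays n K R q s i = {(A, u, w). proper_array n K R q s A \<and>
     {u, w} \<in> pairing A \<and> u \<noteq> w \<and> row u = i \<and> row w = i}"

lemma card_pair_arrays:
  assumes "i \<in> {1..n}"
  shows "card (pair_arrays n K R q s i) = p_num n K R q s * (2 * q i)"
    and "finite (pair_arrays n K R q s i)"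
proof -
  let ?X = "{A. proper_array n K R q s A}"
  let ?D = "\<lambda>A. {(a, b). {a, b} \<in> {p \<in> pairing A. \<forall>v\<in>p. row v = i} \<and> a \<noteq> b}"
  have D: "card (?D A) = 2 * q i" "finite (?D A)" if "A \<in> ?X" for A
  proof -
    let ?P = "{p \<in> pairing A. \<forall>v\<in>p. row v = i}"
    have ok: "cells_ok n K q s A" using that by (simp add: proper_array_iff)
    then have "finite (vertices A)" unfolding cells_ok_def by (metis finite_vertices)
    then have "finite ?P" "\<forall>p\<in>?P. card p = 2"
      using finite_pairing ok by (auto simp: cells_ok_def well_paired_def)
    moreover have "card ?P = q i" using ok assms by (simp add: cells_ok_def)
    ultimately show "card (?D A) = 2 * q i" "finite (?D A)"
      using card_ordered_pairs[of ?P] by simp_all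
  qed
  have eq: "pair_arrays n K R q s i = (SIGMA A:?X. ?D A)"
    by (auto simp: pair_arrays_def)
  show "card (pair_arrays n K R q s i) = p_num n K R q s * (2 * q i)"
    unfolding eq using D finite_proper_arrays[of n K R q s]
    by (subst card_SigmaI) (simp_all add: p_num_def)
  show "finite (pair_arrays n K R q s i)"
    unfolding eq using D finite_proper_arrays[of n K R q s] by (intro finite_SigmaI) auto
qed

lemma card_slots_proper:
  assumes "proper_array n K R q s A" "i \<in> {1..n}"
  shows "card (slots K (marked A) i (num A)) = 2 * q i + row_sum n s i + R i"
    and "col v \<in> {1..K} \<Longrightarrow> row v = i \<Longrightarrow>
      card (slots K (marked A) i (add_cell v (num A))) = 2 * q i + row_sum n s i + R i + 1"
proof -
  have sum: "(\<Sum>j=1..K. num A i j) = 2 * q i + row_sum n s i"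
    using assms by (simp add: proper_array_iff cells_ok_def)
  have "marked A \<subseteq> {1..n} \<times> {1..K}" "card {j. (i, j) \<in> marked A} = R i"
    using assms by (auto simp: proper_array_iff marks_ok_def)
  moreover from this(1) have "{j \<in> {1..K}. (i, j) \<in> marked A} = {j. (i, j) \<in> marked A}" by auto
  ultimately have R: "card {j \<in> {1..K}. (i, j) \<in> marked A} = R i" by simp
  show "card (slots K (marked A) i (num A)) = 2 * q i + row_sum n s i + R i"
    unfolding card_slots R sum ..
  assume v: "col v \<in> {1..K}" "row v = i"
  have "(\<Sum>j=1..K. add_cell v (num A) i j) = (\<Sum>j=1..K. num A i j) + 1"
    using sum_add_cell[OF v(1), of "num A" i] v(2) by simp
  then show "card (slots K (marked A) i (add_cell v (num A))) = 2 * q i + row_sum n s i + R i + 1"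
    unfolding card_slots R using sum by simp
qed

text \<open>Slots are tested one after the other, criticality only after both insertions. The two
  tests agree: a \<open>v\<close> placed at the end of an unmarked cell stops being last only if
  \<open>u\<close> is put to its right at the end, and then \<open>u\<close> is critical.\<close>

lemma slots_iff_not_unmarked_last:
  assumes "row u = i" "row v = i" "col u \<in> {1..K}" "col v \<in> {1..K}"
  shows "v \<in> slots K (marked A) i (num A) \<and> u \<in> slots K (marked A) i (add_cell v (num A)) \<longleftrightarrow>
    pos v \<le> num A (row v) (col v) \<and> pos u \<le> add_cell v (num A) (row u) (col u) \<and>
    \<not> unmarked_last (ins_pair (marked A) u v A) u \<and>
    \<not> unmarked_last (ins_pair (marked A) u v A) (skip u v)"
  using assms
  by (auto simp: slots_def unmarked_last_def rightmost_eq_iff add_cell_def pos_skip split: if_splits)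

lemma pair_cols:
  assumes "proper_array n K R q s A" "{u, w} \<in> pairing A"
  shows "col u \<in> {1..K} \<and> col w \<in> {1..K}"
proof -
  have A: "cells_ok n K q s A" using assms(1) by (simp add: proper_array_iff)
  then have "u \<in> vertices A" "w \<in> vertices A"
    using assms(2) by (auto simp: cells_ok_def well_paired_def partition_on_def)
  then have "num A (row u) (col u) \<noteq> 0" "num A (row w) (col w) \<noteq> 0"
    by (simp_all add: vertices_eq_below below_def)
  moreover have "num A i j = 0" if "(i, j) \<notin> {1..n} \<times> {1..K}" for i j
    using A that by (auto simp: cells_ok_def)
  ultimately show ?thesis by (metis mem_Sigma_iff)
qed

text \<open>Deleting the pair and keeping the marks is a bijection onto arrays with two successive
  slots: \<open>L + R i\<close> for \<open>v\<close>, and one more for \<open>u\<close> because the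
  row has gained a vertex.\<close>

lemma card_pairs_in_slots:
  fixes q :: "nat \<Rightarrow> nat" and s :: "nat \<Rightarrow> nat \<Rightarrow> nat"
  assumes i: "i \<in> {1..n}"
  defines "L \<equiv> 2 * q i + row_sum n s i"
  shows "card {(B, u, w) \<in> pair_arrays n K R (q(i := Suc (q i))) s i.
      \<not> unmarked_last B u \<and> \<not> unmarked_last B w} =
    p_num n K R q s * ((L + R i) * (L + R i + 1))" (is "card ?T = _")
proof -
  let ?X = "{A. proper_array n K R q s A}"
  let ?S1 = "\<lambda>A. slots K (marked A) i (num A)"
  let ?S2 = "\<lambda>A v. slots K (marked A) i (add_cell v (num A))"
  let ?Y = "SIGMA A:?X. SIGMA v:?S1 A. ?S2 A v"
  let ?f = "\<lambda>(A, v, u). (ins_pair (marked A) u v A, u, skip u v)"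
  have "bij_betw ?f ?Y ?T"
  proof (rule bij_betw_imageI)
    show "inj_on ?f ?Y"
    proof (rule inj_onI)
      fix z z' assume eq_z: "?f z = ?f z'"
      obtain A v u where z1: "z = (A, v, u)" by (rule prod_cases3)
      obtain A' v' u' where z2: "z' = (A', v', u')" by (rule prod_cases3)
      note zz = z1 z2
      from eq_z have u: "u = u'" and eq: "ins_pair (marked A) u v A = ins_pair (marked A') u v' A'"
        "skip u v = skip u v'" unfolding zz prod.case prod.inject by metis+
      then have v: "v = v'" by (metis inj_skip injD)
      have m: "marked A = marked A'" using arg_cong[OF eq(1), of marked] by simp
      have "num A = num A'" "pairing A = pairing A'"
        using ins_pair_inject[of "marked A" u v A A'] eq(1) v m by simp_all
      with m have "A = A'" by (intro array.expand) simp
      with u v zz show "z = z'" by simp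
    qed
    show "?f ` ?Y = ?T"
    proof (rule set_eqI, rule iffI)
      fix z assume "z \<in> ?f ` ?Y"
      then obtain A v u where A: "proper_array n K R q s A" and vu: "v \<in> ?S1 A" "u \<in> ?S2 A v"
        and z: "z = (ins_pair (marked A) u v A, u, skip u v)" by auto
      have rc: "row u = i" "row v = i" "col u \<in> {1..K}" "col v \<in> {1..K}"
        using vu by (simp_all add: slots_def)
      have p: "pos v \<le> num A (row v) (col v)" "pos u \<le> add_cell v (num A) (row u) (col u)"
        and ul: "\<not> unmarked_last (ins_pair (marked A) u v A) u"
          "\<not> unmarked_last (ins_pair (marked A) u v A) (skip u v)"
        using slots_iff_not_unmarked_last[OF rc] vu by blast+
      have wp: "well_paired A" using A by (simp add: proper_array_iff cells_ok_def)
      have "proper_array n K R (q(i := Suc (q i))) s (ins_pair (marked A) u v A)"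
        unfolding proper_array_iff
        using A cells_ok_ins_pair[OF rc(1,2) p i rc(3,4)] balanced_ins_pair[OF rc(1,2) p]
          forest_ins_pair_slots[OF _ p wp ul] rc
        by (simp add: proper_array_iff)
      then show "z \<in> ?T"
        using z rc ul skip_neq[of u v] by (auto simp: pair_arrays_def)
    next
      fix z assume zT: "z \<in> ?T"
      obtain B u w where z: "z = (B, u, w)" by (rule prod_cases3)
      from zT have B: "proper_array n K R (q(i := Suc (q i))) s B"
        and uw: "{u, w} \<in> pairing B" "u \<noteq> w" "row u = i" "row w = i"
        and ul: "\<not> unmarked_last B u" "\<not> unmarked_last B w"
        by (simp_all add: z pair_arrays_def)
      have wpB: "well_paired B" using B by (simp add: proper_array_iff cells_ok_def)
      have rw: "row u = row w" using uw(3,4) by simp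
      obtain A v where v: "w = skip u v" "row v = row w" "col v = col w"
        and BA: "B = ins_pair (marked B) u v A" and m: "marked A = marked B"
        and p: "pos v \<le> num A (row v) (col v)" "pos u \<le> add_cell v (num A) (row u) (col u)"
        by (rule ins_pair_surj[OF wpB uw(1,2) rw, where M = "marked B"])
      have cols: "col u \<in> {1..K}" "col w \<in> {1..K}"
        using pair_cols[OF B uw(1)] by auto
      have rc: "row u = i" "row v = i" "col u \<in> {1..K}" "col v \<in> {1..K}"
        using uw(3,4) v(2,3) cols by simp_all
      have BA': "B = ins_pair (marked A) u v A" unfolding m by (rule BA)
      have ul': "\<not> unmarked_last (ins_pair (marked A) u v A) u"
          "\<not> unmarked_last (ins_pair (marked A) u v A) (skip u v)"
        using ul v(1) BA' by simp_all
      have wp: "well_paired A"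
        using wpB well_paired_ins_pair[OF rc(1,2) p, of "marked A", folded BA'] by simp
      have "cells_ok n K q s A \<and> balanced n K A \<and> forest n A"
        using B cells_ok_ins_pair[OF rc(1,2) p i rc(3,4), of q s "marked A"]
          balanced_ins_pair[OF rc(1,2) p, of n K "marked A"]
          forest_ins_pair_slots[OF _ p wp ul', of n] rc
        by (simp only: proper_array_iff BA'[symmetric])
      then have "proper_array n K R q s A"
        using B m by (simp add: proper_array_iff)
      moreover have "v \<in> ?S1 A \<and> u \<in> ?S2 A v"
        using slots_iff_not_unmarked_last[OF rc] p ul' by blast
      ultimately have "(A, v, u) \<in> ?Y" by simp
      then show "z \<in> ?f ` ?Y"
        unfolding z v(1) by (rule rev_image_eqI) (simp add: BA'[symmetric])
    qed
  qed
  then have "card ?T = card ?Y" by (simp add: bij_betw_same_card)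
  also have "\<dots> = (\<Sum>A\<in>?X. card (SIGMA v:?S1 A. ?S2 A v))"
    using finite_proper_arrays[of n K R q s] card_slots(2)
    by (intro card_SigmaI ballI finite_SigmaI) auto
  also have "\<dots> = (\<Sum>A\<in>?X. (L + R i) * (L + R i + 1))"
  proof (rule sum.cong[OF refl])
    fix A assume "A \<in> ?X"
    then have A: "proper_array n K R q s A" by simp
    have "card (SIGMA v:?S1 A. ?S2 A v) = (\<Sum>v\<in>?S1 A. card (?S2 A v))"
      using card_slots(2) by (intro card_SigmaI) auto
    also have "\<dots> = (\<Sum>v\<in>?S1 A. L + R i + 1)"
      using card_slots_proper(2)[OF A i] by (intro sum.cong) (auto simp: slots_def L_def)
    finally show "card (SIGMA v:?S1 A. ?S2 A v) = (L + R i) * (L + R i + 1)"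
      using card_slots_proper(1)[OF A i] by (simp add: L_def)
  qed
  finally show ?thesis by (simp add: p_num_def)
qed

text \<open>The condition on \<open>x\<close> restores what is forgotten when the mark
  \<open>(i, x)\<close> is removed. The bound \<open>Suc (R i) \<le> K\<close> comes for free, since
  the marked columns of row \<open>i\<close> are distinct elements of \<open>{1..K}\<close>.\<close>

lemma marks_ok_remove:
  assumes M: "(i, x) \<in> M" and i: "i \<in> {1..n}" and R: "1 \<le> R i"
  shows "marks_ok n K R (M - {(i, x)}) \<and> x \<in> {1..K} \<longleftrightarrow> marks_ok n K (R(i := Suc (R i))) M"
proof -
  have grid: "M - {(i, x)} \<subseteq> {1..n} \<times> {1..K} \<and> x \<in> {1..K} \<longleftrightarrow> M \<subseteq> {1..n} \<times> {1..K}"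
    using M i by auto
  show ?thesis
  proof (cases "M \<subseteq> {1..n} \<times> {1..K}")
    case True
    then have sub: "{j. (i, j) \<in> M} \<subseteq> {1..K}" by auto
    then have fin: "finite {j. (i, j) \<in> M}" by (rule finite_subset) simp
    have same: "{j. (i, j) \<in> M - {(i, x)}} = {j. (i, j) \<in> M} - {x}" by auto
    have card: "card {j. (i, j) \<in> M} = Suc (card {j. (i, j) \<in> M - {(i, x)}})"
      unfolding same using M by (intro card.remove[OF fin]) simp
    have le: "card {j. (i, j) \<in> M} \<le> K" using card_mono[OF _ sub] by simp
    have "card {j. (k, j) \<in> M - {(i, x)}} = R k \<longleftrightarrow>
        card {j. (k, j) \<in> M} = (R(i := Suc (R i))) k" for k
    proof (cases "k = i")
      case True
      then show ?thesis using card by simp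
    next
      case False
      then have "{j. (k, j) \<in> M - {(i, x)}} = {j. (k, j) \<in> M}" by auto
      with False show ?thesis by simp
    qed
    then have cards: "(\<forall>k\<in>{1..n}. card {j. (k, j) \<in> M - {(i, x)}} = R k) \<longleftrightarrow>
        (\<forall>k\<in>{1..n}. card {j. (k, j) \<in> M} = (R(i := Suc (R i))) k)" by simp
    have "(\<forall>k\<in>{1..n}. 1 \<le> R k \<and> R k \<le> K) \<longleftrightarrow>
        (\<forall>k\<in>{1..n}. 1 \<le> (R(i := Suc (R i))) k \<and> (R(i := Suc (R i))) k \<le> K)"
      if "\<forall>k\<in>{1..n}. card {j. (k, j) \<in> M} = (R(i := Suc (R i))) k"
    proof (rule ball_cong[OF refl])
      fix k
      have "Suc (R i) \<le> K" using that i le by fastforce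
      then show "1 \<le> R k \<and> R k \<le> K \<longleftrightarrow>
          1 \<le> (R(i := Suc (R i))) k \<and> (R(i := Suc (R i))) k \<le> K"
        using R by (cases "k = i") simp_all
    qed
    then show ?thesis
      unfolding marks_ok_def cards using grid True by argo
  next
    case False
    then show ?thesis unfolding marks_ok_def using grid by argo
  qed
qed

text \<open>Deleting the pair and marking the cell of \<open>u\<close> gives
  \<open>Suc (R i)\<close> roots. The vertex \<open>v\<close> has \<open>L + R i + 1\<close> slots,
  and \<open>x\<close> is any root but that of \<open>col v\<close>, which leaves \<open>R i\<close>
  choices. The vertex \<open>u\<close> needs no choice: it is last in its cell.\<close>

lemma card_pairs_unmarked_last:
  fixes q :: "nat \<Rightarrow> nat" and s :: "nat \<Rightarrow> nat \<Rightarrow> nat"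
  assumes i: "i \<in> {1..n}" and R: "1 \<le> R i"
  defines "L \<equiv> 2 * q i + row_sum n s i"
  shows "card {(B, u, w) \<in> pair_arrays n K R (q(i := Suc (q i))) s i. unmarked_last B u} =
    p_num n K (R(i := Suc (R i))) q s * (R i * (L + R i + 1))" (is "card ?T = _")
proof -
  let ?R = "R(i := Suc (R i))"
  let ?X = "{A. proper_array n K ?R q s A}"
  let ?S = "\<lambda>A. slots K (marked A) i (num A)"
  let ?Z = "\<lambda>A v. {x \<in> marked_cols A i. (col v, x) \<notin> (psi_rel A i)\<^sup>*}"
  let ?Y = "SIGMA A:?X. SIGMA v:?S A. ?Z A v"
  let ?B = "\<lambda>A v x. ins_pair (marked A - {(i, x)}) (i, x, num A i x) v A"
  let ?f = "\<lambda>(A, v, x). (?B A v x, (i, x, num A i x), v)"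
  have "bij_betw ?f ?Y ?T"
  proof (rule bij_betw_imageI)
    show "inj_on ?f ?Y"
    proof (rule inj_onI)
      fix z z' assume z: "z \<in> ?Y" "z' \<in> ?Y" and eq: "?f z = ?f z'"
      obtain A v x where z1: "z = (A, v, x)" by (rule prod_cases3)
      obtain A' v' x' where z2: "z' = (A', v', x')" by (rule prod_cases3)
      note zz = z1 z2
      from eq have x: "x = x'" "v = v'" "num A i x = num A' i x"
        and e: "?B A v x = ?B A' v x" unfolding zz prod.case prod.inject by metis+
      have "marked A - {(i, x)} = marked A' - {(i, x)}"
        using arg_cong[OF e, of marked] by simp
      moreover have "(i, x) \<in> marked A" "(i, x) \<in> marked A'"
        using z x by (auto simp: zz marked_cols_def)
      ultimately have m: "marked A = marked A'" by blast
      have "num A = num A'" "pairing A = pairing A'"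
        using ins_pair_inject[of "marked A - {(i, x)}" "(i, x, num A i x)" v A A'] e m x(3)
        by simp_all
      with m have "A = A'" by (intro array.expand) simp
      with x zz show "z = z'" by simp
    qed
    show "?f ` ?Y = ?T"
    proof (rule set_eqI, rule iffI)
      fix z assume "z \<in> ?f ` ?Y"
      then obtain A v x where A: "proper_array n K ?R q s A" and v: "v \<in> ?S A"
        and x: "(i, x) \<in> marked A" "(col v, x) \<notin> (psi_rel A i)\<^sup>*"
        and z: "z = (?B A v x, (i, x, num A i x), v)" by (auto simp: marked_cols_def)
      let ?u = "(i, x, num A i x)"
      \<comment> \<open>The closure is reflexive, so \<open>x\<close> not being reachable from
        \<open>col v\<close> already excludes equality.\<close>
      have xv: "col v \<noteq> x" using x(2) by auto
      have rc: "row v = i" "col v \<in> {1..K}" "pos v \<le> num A i (col v)"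
        using v by (auto simp: slots_def split: if_splits)
      have marks: "marks_ok n K R (marked A - {(i, x)})" "x \<in> {1..K}"
        using marks_ok_remove[where R = R, OF x(1) i R] A by (auto simp: proper_array_iff)
      have wp: "well_paired A" using A by (simp add: proper_array_iff cells_ok_def)
      have p: "row ?u = i" "row v = i" "pos v \<le> num A (row v) (col v)"
        "pos ?u \<le> add_cell v (num A) (row ?u) (col ?u)"
        using rc by (simp_all add: add_cell_def)
      have "proper_array n K R (q(i := Suc (q i))) s (?B A v x)"
        unfolding proper_array_iff
        using A marks forest_ins_pair_root[OF rc x(1) xv i wp] v x(2) balanced_ins_pair[OF p]
          cells_ok_ins_pair[OF p i] rc
        by (simp add: proper_array_iff)
      moreover have "skip ?u v = v" using xv by (intro vertex_eqI) (simp_all add: pos_skip)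
      then have "{?u, v} \<in> pairing (?B A v x)" by simp
      moreover have "unmarked_last (?B A v x) ?u"
        using xv by (simp add: unmarked_last_def rightmost_eq_iff add_cell_def)
      moreover have "?u \<noteq> v" using xv by auto
      ultimately show "z \<in> ?T"
        using z rc by (simp add: pair_arrays_def)
    next
      fix z assume zT: "z \<in> ?T"
      obtain B u w where z: "z = (B, u, w)" by (rule prod_cases3)
      from zT have B: "proper_array n K R (q(i := Suc (q i))) s B"
        and uw: "{u, w} \<in> pairing B" "u \<noteq> w" "row u = i" "row w = i"
        and ul: "unmarked_last B u"
        by (simp_all add: z pair_arrays_def)
      define x where "x = col u"
      have wpB: "well_paired B" and forest: "forest n B"
        using B by (simp_all add: proper_array_iff cells_ok_def)
      have rw: "row u = row w" using uw(3,4) by simp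
      obtain A v where v: "w = skip u v" "row v = row w" "col v = col w"
        and BA: "B = ins_pair (marked B) u v A" and m: "marked A = insert (i, x) (marked B)"
        and p: "pos v \<le> num A (row v) (col v)" "pos u \<le> add_cell v (num A) (row u) (col u)"
        by (rule ins_pair_surj[OF wpB uw(1,2) rw, where M = "insert (i, x) (marked B)"])
      have psi_x: "psi B i x = Some (col w)"
        using psi_unmarked_last[OF wpB uw(1,2) ul] uw x_def by simp
      \<comment> \<open>A partner in the same column would give a loop at \<open>x\<close>, the
        degenerate case of a 2-cycle.\<close>
      have xw: "col w \<noteq> x"
      proof
        assume "col w = x"
        then show False using forest_no_2cycle[OF forest i] psi_x by metis
      qed
      then have wv: "w = v"
        unfolding v(1) using x_def xw v(3) by (intro vertex_eqI) (simp_all add: pos_skip)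
      have "(i, x) \<notin> marked B" using ul uw by (simp add: unmarked_last_def x_def)
      then have mB: "marked B = marked A - {(i, x)}" using m by auto
      \<comment> \<open>As \<open>v\<close> lies in another column, the cell gained only
        \<open>u\<close>; being last, \<open>u\<close> is therefore determined by \<open>A\<close>
        and \<open>x\<close>.\<close>
      have "num B i x = Suc (num A i x)"
        using arg_cong[OF BA, of "\<lambda>X. num X i x"] uw(3,4) xw v(2,3) x_def by (simp add: add_cell_def)
      then have u: "u = (i, x, num A i x)"
        using ul uw by (intro vertex_eqI) (auto simp: unmarked_last_def rightmost_eq_iff x_def)
      have cols: "x \<in> {1..K}" "col v \<in> {1..K}"
        using pair_cols[OF B uw(1)] x_def v(3) by auto
      have BA': "B = ?B A v x" unfolding u[symmetric] mB[symmetric] by (rule BA)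
      have pu: "row u = i" "row v = i" using uw(3,4) v(2) by simp_all
      have wp: "well_paired A"
        using wpB well_paired_ins_pair[OF pu p, of "marked B", folded BA] by simp
      have rc: "row v = i" "col v \<in> {1..K}" "pos v \<le> num A i (col v)"
        using pu cols p by simp_all
      have xA: "(i, x) \<in> marked A" "col v \<noteq> x" using m xw v(3) by auto
      have forestA: "forest n A \<and> v \<in> ?S A \<and> (col v, x) \<notin> (psi_rel A i)\<^sup>*"
        using forest_ins_pair_root[OF rc xA i wp, folded BA'] forest by simp
      have "cells_ok n K q s A"
        using cells_ok_ins_pair[OF pu p i, of K q s "marked B", folded BA] cols x_def B
        by (simp add: proper_array_iff)
      moreover have "balanced n K A"
        using balanced_ins_pair[OF pu p, of n K "marked B", folded BA] B
        by (simp add: proper_array_iff)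
      moreover have "marks_ok n K ?R (marked A)"
        using marks_ok_remove[where R = R, OF xA(1) i R, of K, folded mB] B cols
        by (simp add: proper_array_iff)
      ultimately have "(A, v, x) \<in> ?Y"
        using forestA xA(1) by (simp add: proper_array_iff marked_cols_def)
      moreover have "(B, u, v) = ?f (A, v, x)" using BA' u by simp
      ultimately show "z \<in> ?f ` ?Y"
        unfolding z wv by (metis (no_types, lifting) image_eqI)
    qed
  qed
  then have "card ?T = card ?Y" by (simp add: bij_betw_same_card)
  also have "\<dots> = (\<Sum>A\<in>?X. card (SIGMA v:?S A. ?Z A v))"
  proof (intro card_SigmaI ballI finite_SigmaI)
    fix A v assume "A \<in> ?X"
    then have "marked A \<subseteq> {1..n} \<times> {1..K}" by (simp add: proper_array_iff marks_ok_def)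
    then have "marked_cols A i \<subseteq> {1..K}" by (auto simp: marked_cols_def)
    then show "finite (?Z A v)" by (auto intro: finite_subset)
  qed (rule finite_proper_arrays card_slots(2))+
  also have "\<dots> = (\<Sum>A\<in>?X. (L + R i + 1) * R i)"
  proof (rule sum.cong[OF refl])
    fix A assume "A \<in> ?X"
    then have A: "proper_array n K ?R q s A" by simp
    then have cM: "card (marked_cols A i) = Suc (R i)"
      using i by (simp add: proper_array_iff marks_ok_def marked_cols_def)
    then have finM: "finite (marked_cols A i)" by (metis card.infinite nat.distinct(1))
    \<comment> \<open>The column of a slot lies in exactly one tree, so exactly one of the
      \<open>Suc (R i)\<close> roots is excluded.\<close>
    have Z: "card (?Z A v) = R i" if v: "v \<in> ?S A" for v
    proof -
      have "col v \<in> Domain (psi_rel A i) \<or> col v \<in> marked_cols A i"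
        using v
        by (auto simp: Domain_psi_rel slots_def marked_cols_def nonempty_cols_def split: if_splits)
      then obtain r where r: "r \<in> marked_cols A i" "(col v, r) \<in> (psi_rel A i)\<^sup>*"
        using A i unfolding proper_array_iff forest_iff by blast
      have "?Z A v = marked_cols A i - {r}"
        using r root_unique[of "col v" r A i] by blast
      then show ?thesis using cM r(1) finM by simp
    qed
    have "card (SIGMA v:?S A. ?Z A v) = (\<Sum>v\<in>?S A. card (?Z A v))"
      using card_slots(2) finM by (intro card_SigmaI) auto
    also have "\<dots> = (\<Sum>v\<in>?S A. R i)" using Z by (intro sum.cong) auto
    finally show "card (SIGMA v:?S A. ?Z A v) = (L + R i + 1) * R i"
      using card_slots_proper(1)[OF A i] by (simp add: L_def)
  qed
  finally show ?thesis by (simp add: p_num_def mult.commute)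
qed

lemma not_both_unmarked_last:
  assumes "forest n A" "well_paired A" "{u, w} \<in> pairing A" "u \<noteq> w"
    and "row u = i" "row w = i" "i \<in> {1..n}" "unmarked_last A u"
  shows "\<not> unmarked_last A w"
proof
  assume w: "unmarked_last A w"
  have "psi A i (col u) = Some (col w)" "psi A i (col w) = Some (col u)"
    using psi_unmarked_last[OF assms(2-4,8)] psi_unmarked_last[OF assms(2) _ _ w, of u] assms(3-6)
    by (simp_all add: insert_commute)
  then show False using forest_no_2cycle[OF assms(1,7)] by blast
qed

lemma p_num_recursion:
  fixes q :: "nat \<Rightarrow> nat" and s :: "nat \<Rightarrow> nat \<Rightarrow> nat"
  assumes i: "i \<in> {1..n}" and R: "1 \<le> R i"
  defines "L \<equiv> 2 * q i + row_sum n s i"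
  shows "2 * Suc (q i) * p_num n K R (q(i := Suc (q i))) s =
    (L + R i) * (L + R i + 1) * p_num n K R q s +
    2 * R i * (L + R i + 1) * p_num n K (R(i := Suc (R i))) q s"
proof -
  let ?T = "pair_arrays n K R (q(i := Suc (q i))) s i"
  let ?TB = "{(B, u, w) \<in> ?T. \<not> unmarked_last B u \<and> \<not> unmarked_last B w}"
  let ?TU = "{(B, u, w) \<in> ?T. unmarked_last B u}"
  let ?TW = "{(B, u, w) \<in> ?T. unmarked_last B w}"
  have fin: "finite ?T" by (rule card_pair_arrays(2)[OF i])
  then have fins: "finite ?TB" "finite ?TU" "finite ?TW" by (auto intro: finite_subset)
  have disj: "?TU \<inter> ?TW = {}" "?TB \<inter> (?TU \<union> ?TW) = {}"
    using not_both_unmarked_last[OF _ _ _ _ _ _ i]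
    by (auto simp: pair_arrays_def proper_array_iff cells_ok_def)
  have "?T = ?TB \<union> (?TU \<union> ?TW)" by auto
  then have "card ?T = card (?TB \<union> (?TU \<union> ?TW))" by simp
  also have "\<dots> = card ?TB + (card ?TU + card ?TW)"
    using fins disj by (simp only: card_Un_disjoint finite_UnI)
  \<comment> \<open>Exchanging the two vertices carries one critical case to the other, which gives
    the factor 2.\<close>
  also have "?TW = (\<lambda>(B, u, w). (B, w, u)) ` ?TU"
    by (auto simp: pair_arrays_def insert_commute image_iff)
  also have "card \<dots> = card ?TU"
    by (intro card_image) (auto simp: inj_on_def)
  finally have "card ?T = card ?TB + 2 * card ?TU" by (simp only: mult_2)
  then show ?thesis
    unfolding card_pair_arrays(1)[OF i] card_pairs_in_slots[OF i]
      card_pairs_unmarked_last[where R = R, OF i R] L_def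
    by (simp add: algebra_simps)
qed



subsection \<open>Solving the recursion\<close>

text \<open>Coefficient for \<open>c\<close> pairs in a row with \<open>r + 1\<close> marks and
  \<open>a\<close> mixed vertices. Of the \<open>c\<close> deletions, \<open>t\<close> keep the
  number of marks and \<open>c - t\<close> raise it. For \<open>r = 0\<close> and
  \<open>t \<le> c\<close> the binomial is 1 and the factor of the theorem remains.\<close>

definition pair_coeff :: "nat \<Rightarrow> nat \<Rightarrow> nat \<Rightarrow> nat \<Rightarrow> real" where
  "pair_coeff a r c t = fact (2 * c + a + r) / (2 ^ t * fact t * fact (a + c - t + r)) *
     real ((r + c - t) choose (c - t))"

text \<open>The share \<open>t\<close> of the factor \<open>c + 1\<close> matches the term of the
  recursion that keeps the number of marks.\<close>

lemma pair_coeff_slots: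
  assumes "t \<le> c"
  shows "real (Suc t) * pair_coeff a r (Suc c) (Suc t) =
    real (2 * c + a + r + 1) * real (2 * c + a + r + 2) / 2 * pair_coeff a r c t"
proof -
  obtain d where c: "c = t + d" using assms le_Suc_ex by blast
  define F B X where "F = (fact (2 * c + a + r) :: real)" and "B = real ((r + d) choose d)"
    and "X = (fact (a + d + r) :: real)"
  have "fact (2 * Suc c + a + r) = real (2 * c + a + r + 2) * (real (2 * c + a + r + 1) * F)"
    by (simp add: F_def algebra_simps)
  moreover have "a + Suc c - Suc t + r = a + d + r" "r + Suc c - Suc t = r + d" "Suc c - Suc t = d"
    by (simp_all add: c)
  ultimately have 1: "pair_coeff a r (Suc c) (Suc t) =
      real (2 * c + a + r + 2) * (real (2 * c + a + r + 1) * F) /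
        (2 * 2 ^ t * (real (Suc t) * fact t) * X) * B"
    by (simp only: pair_coeff_def power_Suc fact_Suc[of t] B_def X_def of_nat_mult)
  have "a + c - t + r = a + d + r" "r + c - t = r + d" "c - t = d" by (simp_all add: c)
  then have 2: "pair_coeff a r c t = F / (2 ^ t * fact t * X) * B"
    by (simp only: pair_coeff_def F_def B_def X_def)
  \<comment> \<open>The identity after abstraction of all factorials: the factor
    \<open>Suc t\<close> cancels against the one split off \<open>fact (Suc t)\<close>.\<close>
  have key: "T * (y * (x * F) / (2 * P * (T * Q) * X) * B) = x * y / 2 * (F / (P * Q * X) * B)"
    if "T \<noteq> 0" for T x y P Q :: real
    using that by (simp add: divide_simps)
  show ?thesis unfolding 1 2 by (rule key) simp
qed

text \<open>The complementary share \<open>c + 1 - t\<close> matches the term with one more mark,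
  through the absorption identity for binomial coefficients.\<close>

lemma pair_coeff_roots:
  assumes "t \<le> c"
  shows "real (Suc c - t) * pair_coeff a r (Suc c) t =
    real (Suc r) * real (2 * c + a + r + 2) * pair_coeff a (Suc r) c t"
proof -
  obtain d where c: "c = t + d" using assms le_Suc_ex by blast
  define F where "F = fact (2 * c + a + Suc r) / (2 ^ t * fact t * fact (a + d + Suc r) :: real)"
  have "fact (2 * Suc c + a + r) = real (2 * c + a + r + 2) * fact (2 * c + a + Suc r)"
    by (simp add: algebra_simps)
  then have 1: "pair_coeff a r (Suc c) t =
      real (2 * c + a + r + 2) * F * real (Suc (d + r) choose Suc d)"
    by (simp add: pair_coeff_def F_def c add.commute add.left_commute)
  have 2: "pair_coeff a (Suc r) c t = F * real (Suc (d + r) choose d)"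
    by (simp add: pair_coeff_def F_def c add.commute add.left_commute)
  have "real (Suc d) * real (Suc (d + r) choose Suc d) = real (Suc r) * real (Suc (d + r) choose d)"
    using Suc_times_binomial_add[of d r] by (metis of_nat_mult)
  then have "real (Suc d) * (real (2 * c + a + r + 2) * F * real (Suc (d + r) choose Suc d)) =
      real (Suc r) * real (2 * c + a + r + 2) * (F * real (Suc (d + r) choose d))"
    by (simp add: mult.assoc mult.left_commute)
  moreover have "Suc c - t = Suc d" by (simp add: c)
  ultimately show ?thesis unfolding 1 2 by simp
qed

text \<open>Induction on \<open>c\<close> for all \<open>r\<close> at once. The sum is multiplied by
  \<open>c + 1 = t + (c + 1 - t)\<close>, and the two resulting sums are the two terms of the
  recursion.\<close>

lemma pair_recursion_solution:
  fixes G :: "nat \<Rightarrow> nat \<Rightarrow> real"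
  assumes rec: "\<And>c r. 2 * real (Suc c) * G (Suc c) r =
      real (2 * c + a + r + 1) * real (2 * c + a + r + 2) * G c r +
      2 * real (Suc r) * real (2 * c + a + r + 2) * G c (Suc r)"
  shows "G c r = (\<Sum>t\<le>c. pair_coeff a r c t * G 0 (r + c - t))"
proof (induction c arbitrary: r)
  case 0
  then show ?case by (simp add: pair_coeff_def)
next
  case (Suc c)
  let ?h = "\<lambda>t. pair_coeff a r (Suc c) t * G 0 (r + Suc c - t)"
  have "real (Suc c) * (\<Sum>t\<le>Suc c. ?h t) =
      (\<Sum>t\<le>Suc c. real t * ?h t) + (\<Sum>t\<le>Suc c. real (Suc c - t) * ?h t)"
    unfolding sum_distrib_left sum.distrib[symmetric]
    by (intro sum.cong) (auto simp: of_nat_diff algebra_simps)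
  \<comment> \<open>The term for \<open>t = 0\<close> vanishes, so the index can be shifted.\<close>
  also have "(\<Sum>t\<le>Suc c. real t * ?h t) = (\<Sum>t\<le>c. real (Suc t) * ?h (Suc t))"
    by (subst sum.atMost_Suc_shift) simp
  also have "\<dots> = (\<Sum>t\<le>c. real (2 * c + a + r + 1) * real (2 * c + a + r + 2) / 2 *
      (pair_coeff a r c t * G 0 (r + c - t)))"
  proof (intro sum.cong refl)
    fix t assume "t \<in> {..c}"
    then have t: "t \<le> c" by simp
    have "real (Suc t) * ?h (Suc t) =
        (real (Suc t) * pair_coeff a r (Suc c) (Suc t)) * G 0 (r + c - t)" by simp
    then show "real (Suc t) * ?h (Suc t) = real (2 * c + a + r + 1) * real (2 * c + a + r + 2) / 2 *
        (pair_coeff a r c t * G 0 (r + c - t))"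
      unfolding pair_coeff_slots[OF t] by (simp only: mult.assoc)
  qed
  also have "\<dots> = real (2 * c + a + r + 1) * real (2 * c + a + r + 2) / 2 * G c r"
    unfolding Suc.IH[of r] by (simp only: sum_distrib_left)
  \<comment> \<open>Here the term for \<open>t = Suc c\<close> vanishes.\<close>
  also have "(\<Sum>t\<le>Suc c. real (Suc c - t) * ?h t) = (\<Sum>t\<le>c. real (Suc c - t) * ?h t)"
    by simp
  also have "\<dots> = (\<Sum>t\<le>c. real (Suc r) * real (2 * c + a + r + 2) *
      (pair_coeff a (Suc r) c t * G 0 (Suc r + c - t)))"
  proof (intro sum.cong refl)
    fix t assume "t \<in> {..c}"
    then have t: "t \<le> c" by simp
    have "real (Suc c - t) * ?h t =
        (real (Suc c - t) * pair_coeff a r (Suc c) t) * G 0 (Suc r + c - t)" by simp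
    then show "real (Suc c - t) * ?h t = real (Suc r) * real (2 * c + a + r + 2) *
        (pair_coeff a (Suc r) c t * G 0 (Suc r + c - t))"
      unfolding pair_coeff_roots[OF t] by (simp only: mult.assoc)
  qed
  also have "\<dots> = real (Suc r) * real (2 * c + a + r + 2) * G c (Suc r)"
    unfolding Suc.IH[of "Suc r"] by (simp only: sum_distrib_left)
  also have "real (2 * c + a + r + 1) * real (2 * c + a + r + 2) / 2 * G c r +
      real (Suc r) * real (2 * c + a + r + 2) * G c (Suc r) = real (Suc c) * G (Suc c) r"
  proof -
    have "x * y / 2 * h + v * y * k = z * g" if "2 * z * g = x * y * h + 2 * v * y * k"
      for x y z v g h k :: real
      using that by (simp add: field_simps)
    then show ?thesis using rec[of c r] .
  qed
  finally have "real (Suc c) * (\<Sum>t\<le>Suc c. ?h t) = real (Suc c) * G (Suc c) r" .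
  then show ?case by simp
qed

section \<open>Removal of the non-mixed pairs, one row after another\<close>

lemma p_num_remove_row:
  assumes "i \<in> {1..n}" and "R i = 1"
  shows "real (p_num n K R q s) =
    (\<Sum>t\<le>q i. pair_coeff (row_sum n s i) 0 (q i) t *
       real (p_num n K (R(i := q i - t + 1)) (q(i := 0)) s))"
proof -
  \<comment> \<open>The second argument is the number of marks minus one, so marks stay positive and
    \<open>R i = 1\<close> is the value at \<open>r = 0\<close>.\<close>
  define G where "G c r = real (p_num n K (R(i := Suc r)) (q(i := c)) s)" for c r
  have "2 * real (Suc c) * G (Suc c) r =
      real (2 * c + row_sum n s i + r + 1) * real (2 * c + row_sum n s i + r + 2) * G c r +
      2 * real (Suc r) * real (2 * c + row_sum n s i + r + 2) * G c (Suc r)" for c r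
  proof -
    have "2 * Suc c * p_num n K (R(i := Suc r)) (q(i := Suc c)) s =
        (2 * c + row_sum n s i + r + 1) * (2 * c + row_sum n s i + r + 2) *
          p_num n K (R(i := Suc r)) (q(i := c)) s +
        2 * Suc r * (2 * c + row_sum n s i + r + 2) *
          p_num n K (R(i := Suc (Suc r))) (q(i := c)) s"
      using p_num_recursion[where R = "R(i := Suc r)" and K = K and q = "q(i := c)" and s = s,
          OF assms(1)] by simp
    then show ?thesis
      unfolding G_def by (metis (no_types, lifting) of_nat_add of_nat_mult of_nat_numeral)
  qed
  then have "G (q i) 0 = (\<Sum>t\<le>q i. pair_coeff (row_sum n s i) 0 (q i) t * G 0 (0 + q i - t))"
    by (rule pair_recursion_solution)
  moreover have "R(i := Suc 0) = R" using assms(2) by auto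
  ultimately show ?thesis by (simp add: G_def)
qed

text \<open>Induction on the set \<open>I\<close> of rows already treated. The rows outside
  \<open>I\<close> still have one mark, as \<open>p_num_remove_row\<close> requires.\<close>

lemma p_num_remove_rows:
  assumes "finite I" "I \<subseteq> {1..n}"
  shows "real (p_num n K (\<lambda>_. 1) q s) =
    (\<Sum>t\<in>(\<Pi>\<^sub>E i\<in>I. {0..q i}). (\<Prod>i\<in>I. pair_coeff (row_sum n s i) 0 (q i) (t i)) *
       real (p_num n K (\<lambda>i. if i \<in> I then q i - t i + 1 else 1) (\<lambda>i. if i \<in> I then 0 else q i) s))"
  using assms
proof (induction I rule: finite_induct)
  case empty
  then show ?case by simp
next
  case (insert j I)
  let ?C = "\<lambda>i. pair_coeff (row_sum n s i) 0 (q i)"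
  let ?P = "\<lambda>I t. real (p_num n K (\<lambda>i. if i \<in> I then q i - t i + 1 else 1)
    (\<lambda>i. if i \<in> I then 0 else q i) s)"
  have j: "j \<in> {1..n}" "j \<notin> I" using insert by auto
  have step: "?P I t = (\<Sum>u\<in>{0..q j}. ?C j u * ?P (insert j I) (t(j := u)))" for t
  proof -
    have "(\<lambda>i. if i \<in> I then q i - t i + 1 else 1)(j := q j - u + 1) =
        (\<lambda>i. if i \<in> insert j I then q i - (t(j := u)) i + 1 else 1)" for u
      using j(2) by auto
    moreover have "(\<lambda>i. if i \<in> I then 0 else q i)(j := 0) =
        (\<lambda>i. if i \<in> insert j I then 0 else q i)" by auto
    ultimately show ?thesis
      using p_num_remove_row[where R = "\<lambda>i. if i \<in> I then q i - t i + 1 else 1" and K = K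
          and q = "\<lambda>i. if i \<in> I then 0 else q i" and s = s, OF j(1)] j(2)
      by (simp add: atMost_atLeast0)
  qed
  have prod: "(\<Prod>i\<in>insert j I. ?C i ((t(j := u)) i)) = ?C j u * (\<Prod>i\<in>I. ?C i (t i))" for t u
  proof -
    have "(\<Prod>i\<in>I. ?C i ((t(j := u)) i)) = (\<Prod>i\<in>I. ?C i (t i))"
      using j(2) by (intro prod.cong) auto
    then show ?thesis using insert.hyps by simp
  qed
  \<comment> \<open>Splitting off the exponent \<open>u\<close> of row \<open>j\<close> identifies
    the functions on \<open>insert j I\<close> with pairs.\<close>
  have inj: "inj_on (\<lambda>(u, t). t(j := u)) ({0..q j} \<times> (\<Pi>\<^sub>E i\<in>I. {0..q i}))"
    using inj_combinator[OF j(2), of "\<lambda>i. {0..q i}"] .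
  have "(\<Sum>t\<in>(\<Pi>\<^sub>E i\<in>insert j I. {0..q i}). (\<Prod>i\<in>insert j I. ?C i (t i)) * ?P (insert j I) t) =
      (\<Sum>(u, t)\<in>{0..q j} \<times> (\<Pi>\<^sub>E i\<in>I. {0..q i}).
        (\<Prod>i\<in>insert j I. ?C i ((t(j := u)) i)) * ?P (insert j I) (t(j := u)))"
    unfolding PiE_insert_eq
    by (subst sum.reindex[OF inj]) (simp only: comp_def case_prod_unfold)
  also have "\<dots> = (\<Sum>t\<in>(\<Pi>\<^sub>E i\<in>I. {0..q i}). \<Sum>u\<in>{0..q j}.
        (\<Prod>i\<in>insert j I. ?C i ((t(j := u)) i)) * ?P (insert j I) (t(j := u)))"
    unfolding sum.cartesian_product[symmetric] by (rule sum.swap)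
  also have "\<dots> = (\<Sum>t\<in>(\<Pi>\<^sub>E i\<in>I. {0..q i}). (\<Prod>i\<in>I. ?C i (t i)) * ?P I t)"
    unfolding prod step sum_distrib_left by (intro sum.cong refl) (simp only: mult_ac)
  also have "\<dots> = real (p_num n K (\<lambda>_. 1) q s)"
    using insert.IH insert.prems by simp
  finally show ?case by (rule sym)
qed

text \<open>Parameters matter only at indices of rows. This reconciles the filler values outside
  \<open>{1..n}\<close> left by the induction over rows with those in \<open>v_num\<close>.\<close>

lemma proper_array_cong:
  assumes "\<And>i. i \<in> {1..n} \<Longrightarrow> R i = R' i" "\<And>i. i \<in> {1..n} \<Longrightarrow> q i = q' i"
  shows "proper_array n K R q s A \<longleftrightarrow> proper_array n K R' q' s A"
proof -
  have cong: "(\<forall>i\<in>{1..n}. P i (R i) (q i)) \<longleftrightarrow> (\<forall>i\<in>{1..n}. P i (R' i) (q' i))"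
    for P :: "nat \<Rightarrow> nat \<Rightarrow> nat \<Rightarrow> bool"
    using assms by (intro ball_cong) simp_all
  show ?thesis
    unfolding proper_array_def paired_array_def
    using cong[of "\<lambda>i r q. 1 \<le> r \<and> r \<le> K"]
      cong[of "\<lambda>i r q. (\<Sum>j=1..K. num A i j) = 2 * q + row_sum n s i"]
      cong[of "\<lambda>i r q. card (marked_cols A i) = r"]
      cong[of "\<lambda>i r q. card {p \<in> pairing A. \<forall>v\<in>p. row v = i} = q"]
    by argo
qed

text \<open>The convention for \<open>R i > K\<close> agrees with the count, because
  \<open>paired_array\<close> itself demands \<open>R i \<le> K\<close>.\<close>

lemma v_num_eq_p_num: "v_num n K R s = p_num n K R (\<lambda>_. 0) s"
proof (cases "\<exists>i\<in>{1..n}. R i > K")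
  case True
  then have "{A. proper_array n K R (\<lambda>_. 0) s A} = {}"
    by (auto simp: proper_array_def paired_array_def leD)
  with True show ?thesis by (simp add: v_num_def p_num_def)
next
  case False
  then show ?thesis by (simp add: v_num_def p_num_def)
qed

theorem theorem2p7:
  fixes n :: nat and q :: "nat \<Rightarrow> nat" and s :: "nat \<Rightarrow> nat \<Rightarrow> nat"
  assumes "n \<ge> 1"
    and "\<And>i k. i \<in> {1..n} \<Longrightarrow> k \<in> {1..n} \<Longrightarrow> s k i = s i k"
  shows "(\<forall>K\<ge>1. real (c_num n K q s) =
            (\<Sum>t\<in>(\<Pi>\<^sub>E i\<in>{1..n}. {0..q i}).
               (\<Prod>i=1..n. fact (2 * q i + row_sum n s i) /
                  (2 ^ t i * fact (t i) * fact (row_sum n s i + q i - t i))) *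
               real (v_num n K (\<lambda>i. q i - t i + 1) s)))
       \<and> ((\<forall>R :: nat \<Rightarrow> nat. (\<forall>i\<in>{1..n}. 1 \<le> R i \<and> R i \<le> q i + 1) \<longrightarrow>
              (\<exists>P :: real poly. \<forall>K\<ge>1. real (v_num n K R s) = poly P (real K)))
          \<longrightarrow> (\<exists>P :: real poly. \<forall>K\<ge>1. real (c_num n K q s) = poly P (real K)))"
    (is "?formula \<and> ?polynomial")
proof
  define coeff :: "(nat \<Rightarrow> nat) \<Rightarrow> real" where
    "coeff t = (\<Prod>i=1..n. fact (2 * q i + row_sum n s i) /
       (2 ^ t i * fact (t i) * fact (row_sum n s i + q i - t i)))" for t
  let ?T = "\<Pi>\<^sub>E i\<in>{1..n}. {0..q i}"
  have formula: "real (c_num n K q s) =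
      (\<Sum>t\<in>?T. coeff t * real (v_num n K (\<lambda>i. q i - t i + 1) s))" for K
  proof -
    have "(\<Prod>i=1..n. pair_coeff (row_sum n s i) 0 (q i) (t i)) = coeff t" for t
      by (simp add: coeff_def pair_coeff_def)
    moreover have "p_num n K (\<lambda>i. if i \<in> {1..n} then q i - t i + 1 else 1)
        (\<lambda>i. if i \<in> {1..n} then 0 else q i) s = v_num n K (\<lambda>i. q i - t i + 1) s" for t
      unfolding v_num_eq_p_num p_num_def
      by (intro arg_cong[where f = card] Collect_cong proper_array_cong) simp_all
    moreover have "c_num n K q s = p_num n K (\<lambda>_. 1) q s" by (simp add: c_num_def p_num_def)
    ultimately show ?thesis using p_num_remove_rows[of "{1..n}" n K q s] by simp
  qed
  then show ?formula by (simp add: coeff_def)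
  show ?polynomial
  proof
    assume poly: "\<forall>R :: nat \<Rightarrow> nat. (\<forall>i\<in>{1..n}. 1 \<le> R i \<and> R i \<le> q i + 1) \<longrightarrow>
      (\<exists>P :: real poly. \<forall>K\<ge>1. real (v_num n K R s) = poly P (real K))"
    have "\<exists>P :: real poly. \<forall>K\<ge>1. real (v_num n K (\<lambda>i. q i - t i + 1) s) = poly P (real K)" for t
      \<comment> \<open>By truncated subtraction, \<open>q i - t i + 1\<close> lies between 1 and
        \<open>q i + 1\<close> for every \<open>t\<close>, so a polynomial can be chosen for all
        \<open>t\<close> at once.\<close>
      using poly by auto
    then obtain P :: "(nat \<Rightarrow> nat) \<Rightarrow> real poly"
      where P: "\<And>t K. K \<ge> 1 \<Longrightarrow> real (v_num n K (\<lambda>i. q i - t i + 1) s) = poly (P t) (real K)"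
      by metis
    \<comment> \<open>The coefficients and the index set of the sum do not depend on
      \<open>K\<close>.\<close>
    have "real (c_num n K q s) = poly (\<Sum>t\<in>?T. smult (coeff t) (P t)) (real K)" if "K \<ge> 1" for K
      using P[OF that] by (simp add: formula poly_sum)
    then show "\<exists>P :: real poly. \<forall>K\<ge>1. real (c_num n K q s) = poly P (real K)" by blast
  qed
qed

end
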